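(* The variety of planes contained in $Y$ is isomorphic to $\mathbb{P}(W)\times\mathbb{P}(W^* )$.
   Context: Work over $\mathbb{C}$. $W$ is a 3-dimensional vector space, and $\mathbb{P}(V)$ denotes the space of lines in $V$. View elements $R$ of $\mathbb{C}^2\otimes\mathbb{C}^3\otimes W$ as $2\times 3$ matrices with entries in $W$; $(A,B)\in GL(2)\times GL(3)$ acts by $R\mapsto ARB^{-1}$. $Y$ is the GIT quotient of $\mathbb{P}(\mathbb{C}^2\otimes\mathbb{C}^3\otimes W)$ by this action (points of $Y$ are orbits of matrices whose three maximal minors are linearly independent in $S^2W$); it is a smooth Fano 6-fold of Picard number 1 and index 3. $Y$ is isomorphic to the closed subvariety of $\mathrm{Gr}(2,\mathfrak{sl}(W))$ consisting of the abelian planes, i.e. the 2-dimensional subspaces of $\mathfrak{sl}(W)$ whose elements commute with each other as matrices. The Plücker embedding $\mathrm{Gr}(2,\mathfrak{sl}(W))\subset\mathbb{P}(\wedge^2\mathfrak{sl}(W))$ restricts on $Y$ to the embedding by the ample generator of $\mathrm{Pic}(Y)$. A plane contained in $Y$ is a linearly embedded $\mathbb{P}^2\subset\mathbb{P}(\wedge^2\mathfrak{sl}(W))$ contained in $Y$. *)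

theory Defs
  imports "HOL-Analysis.Analysis"
begin

section \<open>Projective algebraic geometry over the complex numbers\<close>

text \<open>
  Vector spaces are the coordinate spaces \<^typ>\<open>complex ^ 'n\<close> with scalar multiplication
  \<open>*s\<close> and their linear subspaces (\<open>vec.subspace\<close>); \<open>*s\<close>, \<open>vec.span\<close> and \<open>vec.dim\<close> are
  complex-linear notions.  A point of a projective space is a line, represented as a
  one-dimensional linear subspace.
\<close>

definition Gr :: "nat \<Rightarrow> (complex ^ 'n) set \<Rightarrow> (complex ^ 'n) set set" where
  "Gr k V = {U. vec.subspace U \<and> U \<subseteq> V \<and> vec.dim U = k}"

definition proj :: "(complex ^ 'n) set \<Rightarrow> (complex ^ 'n) set set" where
  "proj V = Gr 1 V"

text \<open>The zero polynomial is homogeneous of every degree.\<close>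

inductive hom_poly :: "nat \<Rightarrow> (complex ^ 'n \<Rightarrow> complex) \<Rightarrow> bool" where
  const: "hom_poly 0 (\<lambda>x. c)"
| coord: "hom_poly 1 (\<lambda>x. x $ i)"
| add: "hom_poly d f \<Longrightarrow> hom_poly d g \<Longrightarrow> hom_poly d (\<lambda>x. f x + g x)"
| mult: "hom_poly d f \<Longrightarrow> hom_poly e g \<Longrightarrow> hom_poly (d + e) (\<lambda>x. f x * g x)"

definition zariski_closed :: "(complex ^ 'n) set set \<Rightarrow> bool" where
  "zariski_closed X \<longleftrightarrow>
     (\<exists>F. (\<forall>f\<in>F. \<exists>d. hom_poly d f) \<and> X = {L \<in> proj UNIV. \<forall>f\<in>F. \<forall>x\<in>L. f x = 0})"

definition zariski_open :: "(complex ^ 'n) set set \<Rightarrow> bool" where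
  "zariski_open U \<longleftrightarrow> U \<subseteq> proj UNIV \<and> zariski_closed (proj UNIV - U)"

text \<open>
  A map between subsets of projective spaces is regular if, near every point, it is given by
  homogeneous polynomials of a common degree without common zeros.
\<close>

definition regular_map ::
  "(complex ^ 'n) set set \<Rightarrow> (complex ^ 'm) set set
     \<Rightarrow> ((complex ^ 'n) set \<Rightarrow> (complex ^ 'm) set) \<Rightarrow> bool" where
  "regular_map X Z f \<longleftrightarrow> f ` X \<subseteq> Z \<and>
     (\<forall>P\<in>X. \<exists>U d F. zariski_open U \<and> P \<in> U \<and> (\<forall>j. hom_poly d (\<lambda>x. F x $ j)) \<and>
        (\<forall>L\<in>X \<inter> U. \<forall>x\<in>L. x \<noteq> 0 \<longrightarrow> F x \<noteq> 0 \<and> f L = vec.span {F x}))"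

definition isomorphic_varieties ::
  "(complex ^ 'n) set set \<Rightarrow> (complex ^ 'm) set set \<Rightarrow> bool" where
  "isomorphic_varieties X Z \<longleftrightarrow> zariski_closed X \<and> zariski_closed Z \<and>
     (\<exists>f g. regular_map X Z f \<and> regular_map Z X g \<and>
        (\<forall>L\<in>X. g (f L) = L) \<and> (\<forall>M\<in>Z. f (g M) = M))"

subsection \<open>Products of projective spaces\<close>

definition tensor :: "complex ^ 'n \<Rightarrow> complex ^ 'm \<Rightarrow> complex ^ ('n \<times> 'm)" where
  "tensor v h = (\<chi> p. v $ fst p * h $ snd p)"

definition segre :: "(complex ^ 'n) set \<times> (complex ^ 'm) set \<Rightarrow> (complex ^ ('n \<times> 'm)) set" where
  "segre = (\<lambda>(L, M). vec.span {tensor v h | v h. v \<in> L \<and> h \<in> M})"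

text \<open>\<open>X \<times> Z\<close> as a projective variety, through the Segre embedding.\<close>

definition prod_variety ::
  "(complex ^ 'n) set set \<Rightarrow> (complex ^ 'm) set set \<Rightarrow> (complex ^ ('n \<times> 'm)) set set" where
  "prod_variety X Z = segre ` (X \<times> Z)"

subsection \<open>Exterior powers and the Pluecker embedding\<close>

text \<open>
  The \<open>k\<close>-th exterior power of a space is realised inside its \<open>k\<close>-th tensor power as the space
  of antisymmetric tensors, where \<open>k\<close> is the cardinality of the type \<open>'k\<close>.  The coordinates of
  the tensor power are indexed by \<open>k\<close>-tuples \<^typ>\<open>'n ^ 'k\<close> of indices, and the coordinate of
  \<open>v\<^sub>1 \<and> \<dots> \<and> v\<^sub>k\<close> at a tuple \<open>I\<close> is the determinant with entries \<open>v\<^sub>a $ (I $ b)\<close>.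
\<close>

definition wedge :: "complex ^ 'n ^ 'k \<Rightarrow> complex ^ ('n ^ 'k)" where
  "wedge v = (\<chi> I. det (\<chi> a b. v $ a $ (I $ b)))"

definition exterior_power :: "(complex ^ 'n) set \<Rightarrow> (complex ^ ('n ^ 'k)) set" where
  "exterior_power V = vec.span {wedge v | v. \<forall>a. v $ a \<in> V}"

text \<open>
  If \<open>U\<close> has dimension \<open>k\<close>, its \<open>k\<close>-th exterior power is a line; sending \<open>U\<close> to this line is
  the Pluecker embedding of the Grassmannian of \<open>k\<close>-dimensional subspaces.
\<close>

definition pluecker :: "(complex ^ 'n) set set \<Rightarrow> (complex ^ ('n ^ 'k)) set set" where
  "pluecker G = exterior_power ` G"

section \<open>The variety of abelian planes in \<open>sl(W)\<close>\<close>

text \<open>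
  \<open>W = \<complex>\<^sup>3\<close> after the choice of a basis.  Elements of the dual space are written in the dual
  basis: \<open>h\<close> stands for the linear form \<open>w \<mapsto> \<Sum>i. h $ i * w $ i\<close>.
\<close>

definition W :: "(complex ^ 3) set" where "W = UNIV"

definition W_dual :: "(complex ^ 3) set" where "W_dual = UNIV"

text \<open>
  Endomorphisms of \<open>W\<close> are written as vectors indexed by pairs, since on \<^typ>\<open>complex ^ 3 ^ 3\<close> the operation
  \<open>*s\<close> is not multiplication by complex scalars.
\<close>

definition endo_matrix :: "complex ^ (3 \<times> 3) \<Rightarrow> complex ^ 3 ^ 3" where
  "endo_matrix x = (\<chi> i j. x $ (i, j))"

definition sl_W :: "(complex ^ (3 \<times> 3)) set" where
  "sl_W = {x. trace (endo_matrix x) = 0}"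

definition abelian_planes :: "(complex ^ (3 \<times> 3)) set set" where
  "abelian_planes = {A \<in> Gr 2 sl_W. \<forall>x\<in>A. \<forall>y\<in>A.
     endo_matrix x ** endo_matrix y = endo_matrix y ** endo_matrix x}"

definition Y :: "(complex ^ ((3 \<times> 3) ^ 2)) set set" where
  "Y = pluecker abelian_planes"

text \<open>
  A linearly embedded projective plane is \<open>proj E\<close> for a three-dimensional subspace \<open>E\<close>, so the
  planes contained in \<open>Y\<close> form a subset of a Grassmannian, regarded as a projective variety
  through the Pluecker embedding.
\<close>

definition planes_in_Y :: "(complex ^ ((3 \<times> 3) ^ 2)) set set" where
  "planes_in_Y = {E \<in> Gr 3 (exterior_power sl_W). proj E \<subseteq> Y}"

definition variety_of_planes_in_Y :: "(complex ^ (((3 \<times> 3) ^ 2) ^ 3)) set set" where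
  "variety_of_planes_in_Y = pluecker planes_in_Y"

end

theory Submission imports Defs begin

text \<open>
  A plane in a Grassmannian of two-dimensional subspaces consists either of all
  two-dimensional subspaces of a three-dimensional space, or of those that contain a fixed line
  \<open>\<langle>x\<rangle>\<close> and lie in a fixed four-dimensional space.  For abelian planes in \<open>sl(W)\<close> the first
  kind would give a four-dimensional commutative space of matrices \<open>\<langle>I, x, y, w\<rangle>\<close>.  Such a space
  has no cyclic vector, which makes any two of its traceless elements proportional modulo \<open>I\<close>, so
  this kind does not occur.  In the second kind the four-dimensional space centralises \<open>x\<close>;
  hence \<open>x\<close> has no cyclic vector, \<open>x\<close> is the traceless part of some \<open>z = v \<otimes> h\<close>, and the
  plane is \<open>x \<and> C(x)\<close> with \<open>C(x)\<close> the centraliser of \<open>x\<close> in \<open>sl(W)\<close>.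

  The Pluecker coordinates of \<open>x \<and> C(x)\<close> are locally polynomials of degree six in \<open>z\<close>.
  Conversely, the projection of \<open>\<Lambda>\<^sup>3(\<Lambda>\<^sup>2 sl(W))\<close> to \<open>S\<^sup>2 sl(W) \<otimes> \<Lambda>\<^sup>4 sl(W)\<close> maps the Pluecker
  vector to a multiple of \<open>x\<^sup>2 \<otimes> \<Lambda>\<^sup>4 C(x)\<close>, from which \<open>x\<close> and then \<open>z\<close> can be read off.  Since
  the Pluecker vector is in turn a fixed linear function of this projection, the same formulas
  yield equations for the variety of planes.
\<close>

section \<open>Families of vectors and exterior powers\<close>

text \<open>Independence of the indexed family, not of its range, so that a repeated vector counts
  as a dependence.\<close>

definition fam_indep :: "complex ^ 'n ^ 'k \<Rightarrow> bool" where
  "fam_indep b \<longleftrightarrow> (\<forall>c. (\<Sum>a\<in>UNIV. c a *s b $ a) = 0 \<longrightarrow> (\<forall>a. c a = 0))"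

abbreviation span_fam :: "complex ^ 'n ^ 'k \<Rightarrow> (complex ^ 'n) set" where
  "span_fam b \<equiv> vec.span (range (($) b))"

lemma in_span_fam: "x \<in> span_fam b \<longleftrightarrow> (\<exists>c. x = (\<Sum>a\<in>UNIV. c a *s b $ a))"
proof
  assume "x \<in> span_fam b"
  then show "\<exists>c. x = (\<Sum>a\<in>UNIV. c a *s b $ a)"
  proof (induction rule: vec.span_induct_alt)
    case base
    show ?case by (rule exI[of _ "\<lambda>_. 0"]) simp
  next
    case (step d v y)
    then obtain c k where c: "y = (\<Sum>a\<in>UNIV. c a *s b $ a)" and k: "v = b $ k" by auto
    have "d *s v = (\<Sum>a\<in>UNIV. (if a = k then d else 0) *s b $ a)"
      by (simp add: k if_distrib[of "\<lambda>c. c *s _"] cong: if_cong)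
    then show ?case
      by (intro exI[of _ "\<lambda>a. (if a = k then d else 0) + c a"])
        (simp add: c vec.scale_left_distrib sum.distrib)
  qed
next
  assume "\<exists>c. x = (\<Sum>a\<in>UNIV. c a *s b $ a)"
  then obtain c where "x = (\<Sum>a\<in>UNIV. c a *s b $ a)" by blast
  moreover have "c a *s b $ a \<in> span_fam b" for a
    by (intro vec.span_scale vec.span_base) simp
  ultimately show "x \<in> span_fam b" by (simp add: vec.span_sum)
qed

lemma fam_indep_inj:
  assumes "fam_indep b" shows "inj (($) b)"
proof (rule injI, rule ccontr)
  fix i j assume eq: "b $ i = b $ j" and ne: "i \<noteq> j"
  let ?c = "\<lambda>a. (if a = i then 1 else 0) - (if a = j then 1 else 0) :: complex"
  have "(\<Sum>a\<in>UNIV. ?c a *s b $ a) = 0"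
    using eq by (simp add: vec.scale_left_diff_distrib sum_subtractf if_distrib[of "\<lambda>c. c *s _"] cong: if_cong)
  then have "?c i = 0" using assms unfolding fam_indep_def by (elim allE[of _ ?c]) blast
  then show False using ne by simp
qed

lemma fam_indep_independent:
  assumes "fam_indep b" shows "vec.independent (range (($) b))"
proof (rule vec.independent_if_scalars_zero)
  show "finite (range (($) b))" by simp
  fix f x
  assume s: "(\<Sum>x\<in>range (($) b). f x *s x) = 0" and x: "x \<in> range (($) b)"
  have "(\<Sum>a\<in>UNIV. f (b $ a) *s b $ a) = 0"
    using s by (simp add: sum.reindex[OF fam_indep_inj[OF assms]])
  then have "\<forall>a. f (b $ a) = 0" using assms unfolding fam_indep_def by (metis (no_types))
  then show "f x = 0" using x by auto
qed

lemma dim_span_fam: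
  fixes b :: "complex ^ 'n ^ 'k"
  assumes "fam_indep b" shows "vec.dim (span_fam b) = CARD('k)"
  using vec.dim_eq_card_independent[OF fam_indep_independent[OF assms]]
    card_image[OF fam_indep_inj[OF assms]] by simp

lemma subspace_eq_span_fam:
  fixes E :: "(complex ^ 'n) set"
  assumes "vec.subspace E" "vec.dim E = CARD('k)"
  obtains b :: "complex ^ 'n ^ 'k" where "fam_indep b" "E = span_fam b"
proof -
  obtain B where B: "B \<subseteq> E" "vec.independent B" "E \<subseteq> vec.span B" "card B = CARD('k)"
    using vec.basis_exists[of E] assms(2) by metis
  have fB: "finite B" using B(2) by (rule vec.finiteI_independent)
  then obtain h where h: "bij_betw h (UNIV :: 'k set) B"
    using B(4) finite_same_card_bij[OF finite[of "UNIV :: 'k set"] fB] by auto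
  let ?b = "(\<chi> a. h a) :: complex ^ 'n ^ 'k"
  have r: "range (($) ?b) = B" using h by (auto simp: bij_betw_def)
  have inj: "inj h" and im: "h ` UNIV = B" using h by (auto simp: bij_betw_def)
  have "fam_indep ?b"
    unfolding fam_indep_def
  proof (intro allI impI)
    fix c :: "'k \<Rightarrow> complex" and a
    assume s: "(\<Sum>a\<in>UNIV. c a *s ?b $ a) = 0"
    have "(\<Sum>v\<in>B. c (inv h v) *s v) = (\<Sum>a\<in>UNIV. c a *s ?b $ a)"
      unfolding im[symmetric] by (simp add: sum.reindex[OF inj] inj)
    then have "\<forall>v\<in>B. c (inv h v) = 0"
      using B(2) fB s unfolding vec.independent_explicit by auto
    then show "c a = 0" using im inj by (metis inv_f_f rangeI)
  qed
  moreover have "E = span_fam ?b"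
    using B assms(1) r by (metis vec.span_subspace)
  ultimately show thesis using that by blast
qed

text \<open>At each index tuple the matrix behind the coordinate of \<open>v\<close> is the
  coefficient matrix times the one for \<open>b\<close>, and \<open>det\<close> is
  multiplicative.\<close>

lemma wedge_combination:
  fixes b :: "complex ^ 'n ^ 'k"
  assumes "\<And>a. v $ a = (\<Sum>c\<in>UNIV. m a c *s b $ c)"
  shows "wedge v = det (\<chi> a c. m a c) *s wedge b"
proof -
  have "(\<chi> a j. v $ a $ (I $ j)) = (\<chi> a c. m a c) ** (\<chi> c j. b $ c $ (I $ j))" for I :: "'n ^ 'k"
    by (simp add: vec_eq_iff assms matrix_matrix_mult_def)
  then show ?thesis
    by (simp add: vec_eq_iff wedge_def det_mul)
qed

text \<open>A nonzero coordinate is a nonzero maximal minor, which forces independent rows.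
  Conversely, independent rows make the columns span, and a basis chosen among the columns gives a
  nonzero minor.\<close>

lemma wedge_nonzero_iff:
  fixes b :: "complex ^ 'n ^ 'k"
  shows "wedge b \<noteq> 0 \<longleftrightarrow> fam_indep b"
proof
  assume "wedge b \<noteq> 0"
  then obtain I where I: "det (\<chi> a c. b $ a $ (I $ c)) \<noteq> 0"
    unfolding vec_eq_iff[of "wedge b"] by (auto simp: wedge_def)
  let ?M = "(\<chi> a c. b $ a $ (I $ c)) :: complex ^ 'k ^ 'k"
  have inv: "\<exists>B. ?M ** B = mat 1"
    using I invertible_det_nz[of ?M] invertible_right_inverse by blast
  show "fam_indep b" unfolding fam_indep_def
  proof (intro allI impI)
    fix c :: "'k \<Rightarrow> complex" and a
    assume s: "(\<Sum>a\<in>UNIV. c a *s b $ a) = 0"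
    have "(\<Sum>a\<in>UNIV. c a * b $ a $ j) = 0" for j
      using arg_cong[OF s, of "\<lambda>v. v $ j"] by simp
    then have "(\<Sum>a\<in>UNIV. c a *s row a ?M) = 0"
      by (simp add: vec_eq_iff row_def)
    then show "c a = 0"
      using inv unfolding matrix_right_invertible_independent_rows by blast
  qed
next
  assume "fam_indep b"
  then have "\<exists>B. b ** B = mat 1"
    unfolding matrix_right_invertible_independent_rows by (simp add: fam_indep_def row_def)
  then have sp: "vec.span (columns b) = UNIV"
    unfolding matrix_right_invertible_span_columns .
  obtain B where B: "B \<subseteq> columns b" "vec.independent B" "columns b \<subseteq> vec.span B"
    using vec.maximal_independent_subset by blast
  have spB: "vec.span B = UNIV"
    using vec.span_minimal[OF B(3) vec.subspace_span] sp by auto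
  then have "card B = CARD('k)"
    using vec.dim_eq_card_independent[OF B(2)] vec.dim_span[of B]
      vec_dim_card[where 'a = complex and 'n = 'k] by simp
  then obtain h where h: "bij_betw h (UNIV :: 'k set) B"
    using finite_same_card_bij[OF finite[of "UNIV :: 'k set"] vec.finiteI_independent[OF B(2)]] by auto
  have rh: "range h = B" using h by (simp add: bij_betw_def)
  have "\<exists>i. h c = column i b" for c
    using rh B(1) unfolding columns_def by blast
  then obtain I where I: "\<And>c. h c = column (I c) b" using choice[of "\<lambda>c i. h c = column i b"] by blast
  let ?M = "(\<chi> a c. b $ a $ (I c)) :: complex ^ 'k ^ 'k"
  have "columns ?M = B"
  proof -
    have "column c ?M = h c" for c by (simp add: I column_def)
    then show ?thesis using rh unfolding columns_def by auto
  qed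
  then have "\<exists>N. ?M ** N = mat 1"
    using spB matrix_right_invertible_span_columns[of ?M] by simp
  then have "det ?M \<noteq> 0"
    using invertible_det_nz[of ?M] invertible_right_inverse by blast
  then have "wedge b $ (\<chi> c. I c) \<noteq> 0" by (simp add: wedge_def)
  then show "wedge b \<noteq> 0" by (metis zero_index)
qed

text \<open>Any other wedge of vectors of the span is a determinant times
  \<open>wedge b\<close>.\<close>

lemma exterior_power_span_fam:
  fixes b :: "complex ^ 'n ^ 'k"
  shows "(exterior_power (span_fam b) :: (complex ^ ('n ^ 'k)) set) = vec.span {wedge b}"
proof -
  have "wedge v \<in> vec.span {wedge b}" if v: "\<forall>a. v $ a \<in> span_fam b" for v :: "complex ^ 'n ^ 'k"
  proof -
    obtain m where "\<And>a. v $ a = (\<Sum>c\<in>UNIV. m a c *s b $ c)"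
      using v unfolding in_span_fam by metis
    from wedge_combination[OF this] show ?thesis
      by (simp add: vec.span_base vec.span_scale)
  qed
  moreover have "\<forall>a. b $ a \<in> span_fam b" by (auto intro: vec.span_base)
  ultimately show ?thesis
    unfolding exterior_power_def
    by (intro vec.span_eq[THEN iffD2] conjI) (auto intro: vec.span_base)
qed

lemma proj_UNIV_iff:
  fixes L :: "(complex ^ 'n) set"
  shows "L \<in> proj UNIV \<longleftrightarrow> (\<exists>x. x \<noteq> 0 \<and> L = vec.span {x})"
proof
  assume "L \<in> proj UNIV"
  then have L: "vec.subspace L" "vec.dim L = 1" by (auto simp: proj_def Gr_def)
  then have "L \<noteq> {0}" using vec.dim_eq_0[of L] by auto
  then obtain x where x: "x \<in> L" "x \<noteq> 0" using vec.subspace_0[OF L(1)] by blast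
  have "vec.span {x} = L"
    using L x by (intro vec.subspace_dim_equal) (auto simp: vec.span_minimal)
  then show "\<exists>x. x \<noteq> 0 \<and> L = vec.span {x}" using x by blast
next
  assume "\<exists>x. x \<noteq> 0 \<and> L = vec.span {x}"
  then show "L \<in> proj UNIV" by (auto simp: proj_def Gr_def)
qed

lemma in_span_singleton: "x \<in> vec.span {y} \<longleftrightarrow> (\<exists>c. x = c *s (y :: complex ^ 'n))"
  by (auto simp: vec.span_singleton)

lemma span_singleton_eq:
  assumes "(x :: complex ^ 'n) \<in> vec.span {y}" "x \<noteq> 0"
  shows "vec.span {x} = vec.span {y}"
proof -
  obtain c where c: "x = c *s y" using assms in_span_singleton by blast
  then have "y = (1 / c) *s x" using assms(2) by (auto simp: vec_eq_iff)
  then have "y \<in> vec.span {x}" using in_span_singleton by blast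
  then show ?thesis using assms by (intro vec.span_eq[THEN iffD2]) auto
qed

section \<open>Homogeneous polynomials and regular maps\<close>

lemma hom_poly_cmult: "hom_poly d f \<Longrightarrow> hom_poly d (\<lambda>x. c * f x)"
  using hom_poly.mult[OF hom_poly.const] by fastforce

lemma hom_poly_multc: "hom_poly d f \<Longrightarrow> hom_poly d (\<lambda>x. f x * c)"
  using hom_poly_cmult[of d f c] by (simp add: mult.commute)

lemma hom_poly_divide: "hom_poly d f \<Longrightarrow> hom_poly d (\<lambda>x. f x / c)"
  using hom_poly_multc[of d f "1 / c"] by simp

lemma hom_poly_zero: "hom_poly d (\<lambda>x. 0)"
proof -
  \<comment> \<open>The rule for constants yields degree 0 only; the zero of degree \<open>d\<close>
    is obtained as 0 times a power of some coordinate.\<close>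
  have "hom_poly d (\<lambda>x. (x $ undefined) ^ d)"
  proof (induction d)
    case 0 show ?case using hom_poly.const[of 1] by simp
  next
    case (Suc d) show ?case using hom_poly.mult[OF hom_poly.coord Suc] by simp
  qed
  from hom_poly_cmult[OF this, of 0] show ?thesis by simp
qed

lemma hom_poly_uminus: "hom_poly d f \<Longrightarrow> hom_poly d (\<lambda>x. - f x)"
  using hom_poly_cmult[of d f "-1"] by simp

lemma hom_poly_diff: "hom_poly d f \<Longrightarrow> hom_poly d g \<Longrightarrow> hom_poly d (\<lambda>x. f x - g x)"
  using hom_poly.add[OF _ hom_poly_uminus] by fastforce

lemma hom_poly_sum: "(\<And>i. i \<in> S \<Longrightarrow> hom_poly d (f i)) \<Longrightarrow> hom_poly d (\<lambda>x. \<Sum>i\<in>S. f i x)"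
  by (induction S rule: infinite_finite_induct) (auto intro: hom_poly_zero hom_poly.add)

lemma hom_poly_if: "hom_poly d f \<Longrightarrow> hom_poly d g \<Longrightarrow> hom_poly d (\<lambda>x. if P then f x else g x)"
  by (cases P) simp_all

lemma hom_poly_mult_eq: "hom_poly d f \<Longrightarrow> hom_poly e g \<Longrightarrow> n = d + e \<Longrightarrow> hom_poly n (\<lambda>x. f x * g x)"
  using hom_poly.mult by blast

lemma hom_poly_compose:
  assumes "hom_poly d f" "\<And>j. hom_poly e (\<lambda>x. G x $ j)"
  shows "hom_poly (d * e) (\<lambda>x. f (G x))"
  using assms(1)
proof (induction)
  case (const c) then show ?case using hom_poly.const by simp
next
  case (coord i) then show ?case using assms(2) by simp
next
  case (add d f g) then show ?case using hom_poly.add by blast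
next
  case (mult d f e' g)
  then show ?case using hom_poly.mult by (simp add: add_mult_distrib)
qed

lemma hom_poly_scale: "hom_poly d f \<Longrightarrow> f (c *s x) = c ^ d * f x"
  by (induction rule: hom_poly.induct) (simp_all add: algebra_simps power_add)

lemma hom_poly_vec_scale:
  assumes "\<And>j. hom_poly d (\<lambda>x. F x $ j)" shows "F (c *s x) = c ^ d *s F x"
  using hom_poly_scale[OF assms] by (simp add: vec_eq_iff)

text \<open>The complement of the common zeros of \<open>F\<close> serves as the open neighbourhood.
  Hence it suffices that \<open>F\<close> is nonzero somewhere on \<open>P\<close> and gives the
  right value wherever it does not vanish.\<close>

lemma regular_mapI:
  assumes im: "f ` X \<subseteq> Z" and X: "X \<subseteq> proj UNIV"
    and loc: "\<And>P. P \<in> X \<Longrightarrow> \<exists>d F. (\<forall>j. hom_poly d (\<lambda>x. F x $ j)) \<and> (\<exists>x\<in>P. F x \<noteq> 0) \<and>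
        (\<forall>L\<in>X. \<forall>x\<in>L. F x \<noteq> 0 \<longrightarrow> f L = vec.span {F x})"
  shows "regular_map X Z f"
  unfolding regular_map_def
proof (intro conjI ballI im)
  fix P assume P: "P \<in> X"
  obtain d F where hp: "\<forall>j. hom_poly d (\<lambda>x. F x $ j)" and ne: "\<exists>x\<in>P. F x \<noteq> 0"
    and val: "\<forall>L\<in>X. \<forall>x\<in>L. F x \<noteq> 0 \<longrightarrow> f L = vec.span {F x}"
    using loc[OF P] by (elim exE conjE)
  define C where "C = {L \<in> proj UNIV. \<forall>g\<in>range (\<lambda>j x. F x $ j). \<forall>x\<in>L. g x = 0}"
  have C: "L \<in> C \<longleftrightarrow> L \<in> proj UNIV \<and> (\<forall>x\<in>L. F x = 0)" for L
    by (auto simp: C_def vec_eq_iff)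
  define U where "U = proj UNIV - C"
  have "zariski_closed C"
    unfolding zariski_closed_def C_def using hp
    by (intro exI[of _ "range (\<lambda>j x. F x $ j)"] conjI refl) blast
  moreover have "proj UNIV - U = C" by (auto simp: U_def C_def)
  ultimately have "zariski_open U" unfolding zariski_open_def by (auto simp: U_def)
  moreover have "P \<in> U" using P X ne by (auto simp: U_def C)
  \<comment> \<open>A line is spanned by any of its nonzero vectors, so by homogeneity
    \<open>F\<close> vanishes at all of them or at none.\<close>
  moreover have "F x \<noteq> 0" if L: "L \<in> X" "L \<in> U" and x: "x \<in> L" "x \<noteq> 0" for L x
  proof
    assume F0: "F x = 0"
    from L obtain y where y: "y \<in> L" "F y \<noteq> 0" by (auto simp: U_def C)
    from L X obtain z where z: "L = vec.span {z}" using proj_UNIV_iff by blast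
    have "y \<in> vec.span {x}" using span_singleton_eq[of x z] x y z by simp
    then obtain c where "y = c *s x" using in_span_singleton by blast
    then show False using hom_poly_vec_scale[of d F] hp F0 y(2) by simp
  qed
  ultimately show "\<exists>U d F. zariski_open U \<and> P \<in> U \<and> (\<forall>j. hom_poly d (\<lambda>x. F x $ j)) \<and>
        (\<forall>L\<in>X \<inter> U. \<forall>x\<in>L. x \<noteq> 0 \<longrightarrow> F x \<noteq> 0 \<and> f L = vec.span {F x})"
    using hp val by (intro exI[of _ U] exI[of _ d] exI[of _ F]) auto
qed

section \<open>Commuting matrices of size three\<close>

definition pair :: "'a \<Rightarrow> 'a \<Rightarrow> 'a ^ 2" where
  "pair a b = (\<chi> k. if k = 1 then a else b)"

definition triple :: "'a \<Rightarrow> 'a \<Rightarrow> 'a \<Rightarrow> 'a ^ 3" where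
  "triple a b c = (\<chi> k. if k = 1 then a else if k = 2 then b else c)"

lemma pair_nth [simp]: "pair a b $ 1 = a" "pair a b $ 2 = b"
  by (simp_all add: pair_def)

lemma triple_nth [simp]: "triple a b c $ 1 = a" "triple a b c $ 2 = b" "triple a b c $ 3 = c"
  by (simp_all add: triple_def)

lemma pair_eta: "pair (J $ 1) (J $ 2) = J"
  by (simp add: vec_eq_iff forall_2)

lemma triple_eta: "triple (J $ 1) (J $ 2) (J $ 3) = J"
  by (simp add: vec_eq_iff forall_3)

lemma range_triple: "range (($) (triple a b c)) = {a, b, c}"
  by (auto simp: image_def UNIV_3)

lemma matrix_index_eqI:
  fixes x y :: "'a ^ ('n :: finite \<times> 'm :: finite)"
  assumes "\<And>i j. x $ (i, j) = y $ (i, j)" shows "x = y"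
  unfolding vec_eq_iff using assms by (auto simp: split_paired_all)

section \<open>Algebra of endomorphisms in coordinates\<close>

definition unit_endo :: "complex ^ (3 \<times> 3)" where
  "unit_endo = (\<chi> p. if fst p = snd p then 1 else 0)"

definition endo_mul :: "complex ^ (3 \<times> 3) \<Rightarrow> complex ^ (3 \<times> 3) \<Rightarrow> complex ^ (3 \<times> 3)" where
  "endo_mul x y = (\<chi> p. \<Sum>k\<in>UNIV. x $ (fst p, k) * y $ (k, snd p))"

definition endo_act :: "complex ^ (3 \<times> 3) \<Rightarrow> complex ^ 3 \<Rightarrow> complex ^ 3" where
  "endo_act x u = (\<chi> i. \<Sum>k\<in>UNIV. x $ (i, k) * u $ k)"

definition endo_trace :: "complex ^ (3 \<times> 3) \<Rightarrow> complex" where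
  "endo_trace x = (\<Sum>i\<in>UNIV. x $ (i, i))"

definition endo_transpose :: "complex ^ (3 \<times> 3) \<Rightarrow> complex ^ (3 \<times> 3)" where
  "endo_transpose x = (\<chi> p. x $ (snd p, fst p))"

lemma endo_matrix_mul: "endo_matrix (endo_mul x y) = endo_matrix x ** endo_matrix y"
  by (simp add: vec_eq_iff endo_matrix_def endo_mul_def matrix_matrix_mult_def)

lemma endo_matrix_inj: "endo_matrix x = endo_matrix y \<longleftrightarrow> x = y"
  by (auto simp: vec_eq_iff endo_matrix_def)

lemma endo_matrix_commute:
  "endo_matrix x ** endo_matrix y = endo_matrix y ** endo_matrix x \<longleftrightarrow> endo_mul x y = endo_mul y x"
  by (simp flip: endo_matrix_mul add: endo_matrix_inj)

lemma sl_W_iff: "x \<in> sl_W \<longleftrightarrow> endo_trace x = 0"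
  by (simp add: sl_W_def endo_trace_def trace_def endo_matrix_def)

lemma unit_endo_nth [simp]: "unit_endo $ (i, j) = (if i = j then 1 else 0)"
  by (simp add: unit_endo_def)

lemma endo_mul_nth: "endo_mul x y $ (i, j) = (\<Sum>k\<in>UNIV. x $ (i, k) * y $ (k, j))"
  by (simp add: endo_mul_def)

lemma endo_act_nth: "endo_act x u $ i = (\<Sum>k\<in>UNIV. x $ (i, k) * u $ k)"
  by (simp add: endo_act_def)

lemma endo_transpose_nth [simp]: "endo_transpose x $ (i, j) = x $ (j, i)"
  by (simp add: endo_transpose_def)

lemma tensor_nth [simp]: "tensor v h $ (i, j) = v $ i * h $ j"
  by (simp add: tensor_def)

lemma endo_mul_unit [simp]: "endo_mul unit_endo x = x" "endo_mul x unit_endo = x"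
  by (simp_all add: vec_eq_iff endo_mul_nth if_distrib[of "\<lambda>c. c * _"] if_distrib[of "\<lambda>c. _ * c"] cong: if_cong)

lemma endo_act_unit [simp]: "endo_act unit_endo u = u"
  by (simp add: vec_eq_iff endo_act_nth if_distrib[of "\<lambda>c. c * _"] cong: if_cong)

lemma endo_act_mul: "endo_act (endo_mul x y) u = endo_act x (endo_act y u)"
  by (simp add: vec_eq_iff endo_act_nth endo_mul_nth sum_3 algebra_simps)

lemma endo_mul_assoc: "endo_mul (endo_mul x y) z = endo_mul x (endo_mul y z)"
  by (simp add: vec_eq_iff endo_mul_nth sum_3 algebra_simps)

lemma endo_act_simps:
  "endo_act (x + y) u = endo_act x u + endo_act y u"
  "endo_act (x - y) u = endo_act x u - endo_act y u"
  "endo_act (c *s x) u = c *s endo_act x u"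
  "endo_act x (u + w) = endo_act x u + endo_act x w"
  "endo_act x (c *s u) = c *s endo_act x u"
  "endo_act x 0 = 0"
  "endo_act 0 u = 0"
  by (simp_all add: vec_eq_iff endo_act_nth sum_3 algebra_simps)

lemma endo_mul_simps:
  "endo_mul (x + y) z = endo_mul x z + endo_mul y z"
  "endo_mul (x - y) z = endo_mul x z - endo_mul y z"
  "endo_mul (c *s x) z = c *s endo_mul x z"
  "endo_mul z (x + y) = endo_mul z x + endo_mul z y"
  "endo_mul z (x - y) = endo_mul z x - endo_mul z y"
  "endo_mul z (c *s x) = c *s endo_mul z x"
  "endo_mul 0 z = 0" "endo_mul z 0 = 0"
  by (simp_all add: vec_eq_iff endo_mul_nth sum_3 algebra_simps)

lemma endo_mul_sum: "endo_mul (\<Sum>a\<in>S. f a) z = (\<Sum>a\<in>S. endo_mul (f a) z)" "endo_mul z (\<Sum>a\<in>S. f a) = (\<Sum>a\<in>S. endo_mul z (f a))"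
  by (induction S rule: infinite_finite_induct) (simp_all add: endo_mul_simps)

lemma endo_act_sum: "endo_act (\<Sum>a\<in>S. f a) u = (\<Sum>a\<in>S. endo_act (f a) u)"
  by (induction S rule: infinite_finite_induct) (simp_all add: endo_act_simps)

lemma endo_trace_simps:
  "endo_trace (x + y) = endo_trace x + endo_trace y"
  "endo_trace (x - y) = endo_trace x - endo_trace y"
  "endo_trace (c *s x) = c * endo_trace x"
  "endo_trace unit_endo = 3"
  "endo_trace 0 = 0"
  by (simp_all add: endo_trace_def sum_3 algebra_simps)

lemma endo_transpose_simps:
  "endo_transpose (x + y) = endo_transpose x + endo_transpose y"
  "endo_transpose (c *s x) = c *s endo_transpose x"
  "endo_transpose unit_endo = unit_endo"
  "endo_transpose (tensor v h) = tensor h v"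
  "endo_transpose (endo_transpose x) = x"
  "endo_mul (endo_transpose x) (endo_transpose y) = endo_transpose (endo_mul y x)"
  "endo_trace (endo_transpose x) = endo_trace x"
  "endo_transpose 0 = 0"
  by (simp_all add: vec_eq_iff endo_mul_nth sum_3 endo_trace_def algebra_simps)

lemma det_triple:
  "det (triple u v w) = u $ 1 * (v $ 2 * w $ 3 - v $ 3 * w $ 2) + u $ 2 * (v $ 3 * w $ 1 - v $ 1 * w $ 3)
     + u $ 3 * (v $ 1 * w $ 2 - v $ 2 * w $ 1 :: complex)"
  by (simp add: det_3 algebra_simps)

lemma four_vectors_dependent:
  fixes w :: "complex ^ 3 ^ 4" shows "\<not> fam_indep w"
  using dim_span_fam[of w] dim_subset_UNIV_cart_gen[of "span_fam w"] by auto

text \<open>The matrix with rows \<open>u, v, w\<close> is invertible and annihilates every row of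
  \<open>n\<close>.\<close>

lemma act_zero_if_det_nonzero:
  assumes "det (triple u v w) \<noteq> 0" "endo_act n u = 0" "endo_act n v = 0" "endo_act n w = 0"
  shows "n = 0"
proof -
  have inj: "triple u v w *v r = 0 \<Longrightarrow> r = 0" for r
    using assms(1) invertible_det_nz[of "triple u v w"] invertible_left_inverse
      matrix_left_invertible_ker by blast
  have "triple u v w *v (\<chi> k. n $ (i, k)) = 0" for i
    using arg_cong[OF assms(2), of "\<lambda>w. w $ i"] arg_cong[OF assms(3), of "\<lambda>w. w $ i"]
      arg_cong[OF assms(4), of "\<lambda>w. w $ i"]
    by (simp add: vec_eq_iff forall_3 endo_act_nth matrix_vector_mult_def sum_3 mult.commute)
  then have "(\<chi> k. n $ (i, k)) = 0" for i using inj by blast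
  then show ?thesis by (simp add: vec_eq_iff)
qed

text \<open>A commutative space of matrices with a cyclic vector has dimension at most three, since its
  elements are determined by their values on the cyclic vector.\<close>

lemma commuting_orbit_dependent:
  fixes n :: "complex ^ (3 \<times> 3) ^ 4"
  assumes "fam_indep n"
    and comm: "\<And>a. endo_mul (n $ a) m1 = endo_mul m1 (n $ a)" "\<And>a. endo_mul (n $ a) m2 = endo_mul m2 (n $ a)"
      "\<And>a. endo_mul (n $ a) m3 = endo_mul m3 (n $ a)"
  shows "det (triple (endo_act m1 u) (endo_act m2 u) (endo_act m3 u)) = 0"
proof (rule ccontr)
  assume nz: "det (triple (endo_act m1 u) (endo_act m2 u) (endo_act m3 u)) \<noteq> 0"
  \<comment> \<open>Four vectors of a three-dimensional space are dependent, so a nontrivial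
    combination \<open>N\<close> of the matrices kills \<open>u\<close>. It commutes with each
    \<open>m\<close>, hence also kills the basis \<open>m1 u, m2 u, m3 u\<close>.\<close>
  obtain c k where c: "(\<Sum>a\<in>UNIV. c a *s endo_act (n $ a) u) = 0" and k: "c k \<noteq> 0"
    using four_vectors_dependent[of "\<chi> a. endo_act (n $ a) u"] unfolding fam_indep_def by auto
  define N where "N = (\<Sum>a\<in>UNIV. c a *s n $ a)"
  have Nu: "endo_act N u = 0" using c by (simp add: N_def endo_act_sum endo_act_simps)
  have Nm: "endo_act N (endo_act m u) = 0" if "\<And>a. endo_mul (n $ a) m = endo_mul m (n $ a)" for m
  proof -
    have "endo_mul N m = endo_mul m N" by (simp add: N_def endo_mul_sum endo_mul_simps that)
    then show ?thesis using Nu by (metis endo_act_mul endo_act_simps(6))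
  qed
  have "N = 0" using act_zero_if_det_nonzero[OF nz Nm Nm Nm] comm by blast
  then show False using assms(1) k unfolding N_def fam_indep_def by blast
qed

section \<open>Matrices without a cyclic vector\<close>

lemma tensor_if_minors:
  fixes N :: "complex ^ ('n :: finite \<times> 'm :: finite)"
  assumes "N $ (i, j) \<noteq> 0" "\<And>r s. N $ (r, s) * N $ (i, j) = N $ (r, j) * N $ (i, s)"
  obtains v h where "N = tensor v h"
proof
  \<comment> \<open>The factors are the pivot column and the pivot row divided by the pivot
    entry.\<close>
  show "N = tensor (\<chi> r. N $ (r, j)) (\<chi> s. N $ (i, s) / N $ (i, j))"
    using assms by (auto simp: vec_eq_iff tensor_def field_simps)
qed

text \<open>The determinant of \<open>u, x u, x\<^sup>2 u\<close> for \<open>u = (p, q, r)\<close> and the matrix \<open>x\<close> with rows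
  \<open>(a, b, c), (d, e, f), (g, h, i)\<close>.\<close>

definition krylov_det :: "complex \<Rightarrow> complex \<Rightarrow> complex \<Rightarrow> complex \<Rightarrow> complex \<Rightarrow> complex \<Rightarrow> complex \<Rightarrow> complex \<Rightarrow> complex
    \<Rightarrow> complex \<Rightarrow> complex \<Rightarrow> complex \<Rightarrow> complex" where
  "krylov_det a b c d e f g h i p q r =
    (let X = a*p+b*q+c*r; Y = d*p+e*q+f*r; Z = g*p+h*q+i*r;
         X' = a*X+b*Y+c*Z; Y' = d*X+e*Y+f*Z; Z' = g*X+h*Y+i*Z
     in p * (Y * Z' - Z * Y') + q * (Z * X' - X * Z') + r * (X * Y' - Y * X'))"

text \<open>If the off-diagonal entry \<open>b\<close> is nonzero, \<open>x + (t / b) I\<close> is the only candidate for a matrix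
  of rank one.\<close>

lemma krylov_det_minors:
  assumes H: "\<And>p q r. krylov_det a b c d e f g h i p q r = 0" and b: "b \<noteq> 0"
  defines "t \<equiv> c*h - i*b"
  shows "(b*d) * (b*b) = (b*e+t) * (b*a+t)" "(b*f) * (b*b) = (b*e+t) * (b*c)"
    "(b*g) * (b*b) = (b*h) * (b*a+t)" "(b*i+t) * (b*b) = (b*h) * (b*c)"
proof -
  \<comment> \<open>\<open>krylov_det\<close> is a cubic form in \<open>p, q, r\<close>; its
    vanishing at these ten vectors amounts to the vanishing of its ten coefficients.\<close>
  have "krylov_det a b c d e f g h i 1 0 0 = 0" "krylov_det a b c d e f g h i 0 1 0 = 0" "krylov_det a b c d e f g h i 0 0 1 = 0"
   "krylov_det a b c d e f g h i 1 1 0 = 0"  "krylov_det a b c d e f g h i 1 (-1) 0 = 0" "krylov_det a b c d e f g h i 0 1 1 = 0"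
   "krylov_det a b c d e f g h i 0 1 (-1) = 0" "krylov_det a b c d e f g h i 1 0 1 = 0"  "krylov_det a b c d e f g h i 1 0 (-1) = 0"
   "krylov_det a b c d e f g h i 1 1 1 = 0" using H by auto
  note eqs = this[unfolded krylov_det_def Let_def]
  show "(b*f) * (b*b) = (b*e+t) * (b*c)" using eqs b unfolding t_def by algebra
  show "(b*g) * (b*b) = (b*h) * (b*a+t)" using eqs b unfolding t_def by algebra
  \<comment> \<open>The value of \<open>t\<close> is the one that makes this minor vanish.\<close>
  show "(b*i+t) * (b*b) = (b*h) * (b*c)" unfolding t_def by algebra
  show "(b*d) * (b*b) = (b*e+t) * (b*a+t)" using eqs b unfolding t_def by algebra
qed

lemma UNIV_three_distinct:
  assumes "i \<noteq> (j::3)" obtains k where "k \<noteq> i" "k \<noteq> j" "UNIV = {i, j, k}"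
proof -
  have "card {i, j} < CARD(3)" using assms by simp
  then have "{i, j} \<noteq> UNIV" by (metis less_irrefl)
  then obtain k where k: "k \<noteq> i" "k \<noteq> j" by blast
  moreover have "card {i, j, k} = CARD(3)" using assms k by simp
  then have "UNIV = {i, j, k}" by (metis card_eq_UNIV_imp_eq_UNIV finite)
  ultimately show thesis using that by blast
qed

text \<open>With the basis ordered as \<open>i, j, k\<close>, the relations of
  \<open>krylov_det_minors\<close> are the minors of \<open>N\<close> through the pivot
  \<open>(i, j)\<close>. So \<open>N\<close> has rank one, and dividing by the entry of
  \<open>x\<close> returns to \<open>x\<close>.\<close>

lemma offdiagonal_noncyclic_rank_one:
  assumes dep: "\<And>u. det (triple u (endo_act x u) (endo_act x (endo_act x u))) = 0"
    and ij: "i \<noteq> j" "x $ (i, j) \<noteq> 0"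
  obtains s v h where "x = s *s unit_endo + tensor v h"
proof -
  obtain k where k: "k \<noteq> i" "k \<noteq> j" and U: "UNIV = {i, j, k}" by (rule UNIV_three_distinct[OF ij(1)])
  have "krylov_det (x$(i,i)) (x$(i,j)) (x$(i,k)) (x$(j,i)) (x$(j,j)) (x$(j,k)) (x$(k,i)) (x$(k,j)) (x$(k,k)) p q r = 0"
    for p q r
  proof -
    define u :: "complex ^ 3" where "u = (\<chi> l. if l = i then p else if l = j then q else r)"
    have u: "u $ i = p" "u $ j = q" "u $ k = r" using ij k by (auto simp: u_def)
    have "(\<Sum>l\<in>UNIV. f l) = f i + f j + f k" for f :: "3 \<Rightarrow> complex"
      unfolding U using ij k by simp
    then have a: "endo_act x w $ l = x$(l,i) * w$i + x$(l,j) * w$j + x$(l,k) * w$k" for w l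
      by (simp add: endo_act_nth)
    define v w where "v = endo_act x u" and "w = endo_act x v"
    \<comment> \<open>Reordering the basis changes the determinant at most by a sign.\<close>
    have "u$i * (v$j * w$k - v$k * w$j) + u$j * (v$k * w$i - v$i * w$k) + u$k * (v$i * w$j - v$j * w$i) = 0"
      using dep[of u] ij k exhaust_3[of i] exhaust_3[of j] exhaust_3[of k]
      unfolding v_def[symmetric] w_def[symmetric] det_triple by (auto simp: algebra_simps)
    then show ?thesis
      unfolding krylov_det_def Let_def v_def w_def a u by simp
  qed
  note min = krylov_det_minors[OF this ij(2)]
  define t where "t = x$(i,k) * x$(k,j) - x$(k,k) * x$(i,j)"
  define N where "N = x$(i,j) *s x + t *s unit_endo"
  have "N $ (r, s) * N $ (i, j) = N $ (r, j) * N $ (i, s)" for r s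
  proof -
    have "r \<in> {i, j, k}" "s \<in> {i, j, k}" using U by auto
    then show ?thesis
      using ij k min unfolding N_def t_def by (auto simp: mult_ac)
  qed
  moreover have "N $ (i, j) \<noteq> 0" using ij by (simp add: N_def)
  ultimately obtain v h where vh: "N = tensor v h" using tensor_if_minors by blast
  have "x = (- t / x$(i,j)) *s unit_endo + (1 / x$(i,j)) *s N"
    using ij by (simp add: N_def vec_eq_iff field_simps)
  also have "(1 / x$(i,j)) *s N = tensor ((1 / x$(i,j)) *s v) h"
    by (simp add: vh vec_eq_iff)
  finally show thesis using that by blast
qed

text \<open>The remaining case is a diagonal matrix. Two of its diagonal entries must agree, and
  subtracting that scalar leaves at most one nonzero entry.\<close>

lemma noncyclic_rank_one:
  assumes dep: "\<And>u. det (triple u (endo_act x u) (endo_act x (endo_act x u))) = 0"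
  obtains s v h where "x = s *s unit_endo + tensor v h"
proof (cases "\<exists>i j. i \<noteq> j \<and> x $ (i, j) \<noteq> 0")
  case True
  then show thesis using offdiagonal_noncyclic_rank_one[OF dep] that by blast
next
  case False
  then have off: "x $ (i, j) = 0" if "i \<noteq> j" for i j using that by blast
  \<comment> \<open>For diagonal \<open>x\<close> and \<open>u = (1, 1, 1)\<close> this is the
    Vandermonde determinant of the diagonal entries.\<close>
  have "det (triple (\<chi> l. 1) (endo_act x (\<chi> l. 1)) (endo_act x (endo_act x (\<chi> l. 1)))) = 0" by (rule dep)
  then have "(x$(1,1) - x$(2,2)) * (x$(2,2) - x$(3,3)) * (x$(3,3) - x$(1,1)) = 0"
    unfolding det_triple by (simp add: endo_act_nth sum_3 off algebra_simps)
  then have "x$(1,1) = x$(2,2) \<or> x$(2,2) = x$(3,3) \<or> x$(3,3) = x$(1,1)" by auto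
  moreover have "(1::3) \<noteq> 2" "(2::3) \<noteq> 3" "(3::3) \<noteq> 1" by simp_all
  ultimately have "\<exists>i j. i \<noteq> j \<and> x$(i,i) = x$(j,j)" by blast
  then obtain i j where ij: "i \<noteq> j" "x$(i,i) = x$(j,j)" by blast
  obtain k where k: "k \<noteq> i" "k \<noteq> j" and U: "UNIV = {i, j, k}" by (rule UNIV_three_distinct[OF ij(1)])
  have "x $ (r, s) = (x$(i,i) *s unit_endo + tensor ((x$(k,k) - x$(i,i)) *s axis k 1) (axis k 1)) $ (r, s)" for r s
  proof -
    have "r \<in> {i, j, k}" "s \<in> {i, j, k}" using U by auto
    then show ?thesis using ij k off by (auto simp: axis_def)
  qed
  then have "x = x$(i,i) *s unit_endo + tensor ((x$(k,k) - x$(i,i)) *s axis k 1) (axis k 1)"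
    by (rule matrix_index_eqI)
  then show thesis by (rule that)
qed

lemma ex_nonzero_of_three_forms:
  assumes "a \<noteq> (0::complex^3)" "b \<noteq> 0" "c \<noteq> 0"
  obtains u where "(\<Sum>k\<in>UNIV. a$k * u$k) \<noteq> 0" "(\<Sum>k\<in>UNIV. b$k * u$k) \<noteq> 0" "(\<Sum>k\<in>UNIV. c$k * u$k) \<noteq> 0"
proof -
  define P where "P a = [:a$1, a$2, a$3:]" for a :: "complex^3"
  have nz: "P a \<noteq> 0" if "a \<noteq> 0" for a using that by (auto simp: P_def vec_eq_iff forall_3)
  have "P a * P b * P c \<noteq> 0" using assms nz by simp
  then obtain t where t: "poly (P a * P b * P c) t \<noteq> 0"
    using poly_all_0_iff_0 by blast
  \<comment> \<open>On \<open>(1, t, t\<^sup>2)\<close> the forms become nonzero polynomials in \<open>t\<close>.\<close>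
  define u :: "complex^3" where "u = triple 1 t (t^2)"
  have "poly (P a) t = (\<Sum>k\<in>UNIV. a$k * u$k)" for a
    by (simp add: P_def u_def sum_3 algebra_simps power2_eq_square)
  then show thesis using that[of u] t by auto
qed

section \<open>No three independent commuting traceless matrices\<close>

definition comm_triple :: "complex ^ (3 \<times> 3) \<Rightarrow> complex ^ (3 \<times> 3) \<Rightarrow> complex ^ (3 \<times> 3) \<Rightarrow> bool" where
  "comm_triple x y w \<longleftrightarrow> endo_trace x = 0 \<and> endo_trace y = 0 \<and> endo_trace w = 0
     \<and> endo_mul x y = endo_mul y x \<and> endo_mul x w = endo_mul w x \<and> endo_mul y w = endo_mul w y \<and> fam_indep (triple x y w)"

definition quad :: "'a \<Rightarrow> 'a \<Rightarrow> 'a \<Rightarrow> 'a \<Rightarrow> 'a ^ 4" where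
  "quad a b c d = (\<chi> k. if k = 1 then a else if k = 2 then b else if k = 3 then c else d)"

lemma quad_nth [simp]: "quad a b c d $ 1 = a" "quad a b c d $ 2 = b" "quad a b c d $ 3 = c" "quad a b c d $ 4 = d"
  by (simp_all add: quad_def)

lemma fam_indep_triple:
  "fam_indep (triple x y w) \<longleftrightarrow> (\<forall>a b c. a *s x + b *s y + c *s w = 0 \<longrightarrow> a = 0 \<and> b = 0 \<and> c = 0)"
  unfolding fam_indep_def sum_3 forall_3
  by (auto dest: spec[of _ "\<lambda>k. triple _ _ _ $ k"])

text \<open>The trace isolates the coefficient of \<open>unit_endo\<close>.\<close>

lemma fam_indep_triple_unit_endo:
  assumes "fam_indep (triple x y w)" "endo_trace x = 0" "endo_trace y = 0" "endo_trace w = 0"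
  shows "fam_indep (quad unit_endo x y w)"
  unfolding fam_indep_def
proof (intro allI impI)
  fix c :: "4 \<Rightarrow> complex" and a
  assume "(\<Sum>a\<in>UNIV. c a *s quad unit_endo x y w $ a) = 0"
  then have s: "c 1 *s unit_endo + c 2 *s x + c 3 *s y + c 4 *s w = 0" by (simp add: sum_4)
  have "c 1 = 0" using arg_cong[OF s, of endo_trace] assms by (simp add: endo_trace_simps)
  moreover from this have "c 2 = 0 \<and> c 3 = 0 \<and> c 4 = 0"
    using s assms(1) unfolding fam_indep_triple by simp
  ultimately show "c a = 0" using exhaust_4[of a] by auto
qed

text \<open>The four independent matrices \<open>unit_endo, x, y, w\<close> commute with each
  \<open>m\<close>, so no three matrices of their commutant carry a vector to a basis.\<close>

lemma comm_triple_det: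
  assumes "comm_triple x y w"
    and m: "\<And>m. m \<in> {m1, m2, m3} \<Longrightarrow> endo_mul m x = endo_mul x m \<and> endo_mul m y = endo_mul y m \<and> endo_mul m w = endo_mul w m"
  shows "det (triple (endo_act m1 u) (endo_act m2 u) (endo_act m3 u)) = 0"
proof (rule commuting_orbit_dependent[of "quad unit_endo x y w"])
  show "fam_indep (quad unit_endo x y w)"
    using assms(1) fam_indep_triple_unit_endo by (auto simp: comm_triple_def)
  have *: "endo_mul (quad unit_endo x y w $ a) m = endo_mul m (quad unit_endo x y w $ a)" if "m \<in> {m1, m2, m3}" for a m
    using exhaust_4[of a] m[OF that] by auto
  show "endo_mul (quad unit_endo x y w $ a) m1 = endo_mul m1 (quad unit_endo x y w $ a)"
    "endo_mul (quad unit_endo x y w $ a) m2 = endo_mul m2 (quad unit_endo x y w $ a)"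
    "endo_mul (quad unit_endo x y w $ a) m3 = endo_mul m3 (quad unit_endo x y w $ a)" for a
    using * by auto
qed

text \<open>The powers \<open>1, x, x^2\<close> commute with the triple, hence \<open>x\<close> has
  no cyclic vector.\<close>

lemma comm_triple_rank_one:
  assumes ct: "comm_triple x y w"
  obtains s v h where "x = s *s unit_endo + tensor v h"
proof (rule noncyclic_rank_one)
  fix u
  have "det (triple (endo_act unit_endo u) (endo_act x u) (endo_act (endo_mul x x) u)) = 0"
  proof (rule comm_triple_det[OF ct])
    have "endo_mul (endo_mul x x) z = endo_mul z (endo_mul x x)" if "endo_mul x z = endo_mul z x" for z
      using that by (metis endo_mul_assoc)
    then show "endo_mul m x = endo_mul x m \<and> endo_mul m y = endo_mul y m \<and> endo_mul m w = endo_mul w m" if "m \<in> {unit_endo, x, endo_mul x x}" for m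
      using that ct by (auto simp: comm_triple_def)
  qed
  then show "det (triple u (endo_act x u) (endo_act x (endo_act x u))) = 0" by (simp add: endo_act_mul)
qed (use that in blast)

text \<open>Modulo \<open>u\<close>, the vectors \<open>x u\<close> and \<open>y u\<close> are
  \<open>h1(u) v1\<close> and \<open>h2(u) v2\<close>, so
  \<open>h1(u) h2(u) det(u, v1, v2) = 0\<close> for every \<open>u\<close>. For independent
  \<open>v1, v2\<close> a general \<open>u\<close> contradicts this.\<close>

lemma comm_triple_parallel:
  assumes ct: "comm_triple x y w" and x: "x = s1 *s unit_endo + tensor v1 h1" and y: "y = s2 *s unit_endo + tensor v2 h2"
    and nz: "h1 \<noteq> 0" "h2 \<noteq> 0"
  shows "v1 $ i * v2 $ j = v1 $ j * v2 $ i"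
proof (rule ccontr)
  assume ne: "v1 $ i * v2 $ j \<noteq> v1 $ j * v2 $ i"
  \<comment> \<open>The cross product of \<open>v1\<close> and \<open>v2\<close>, which represents
    the form \<open>det(u, v1, v2)\<close> in \<open>u\<close>.\<close>
  define c where "c = triple (v1$2 * v2$3 - v1$3 * v2$2) (v1$3 * v2$1 - v1$1 * v2$3) (v1$1 * v2$2 - v1$2 * v2$1)"
  have "c \<noteq> 0"
    using ne exhaust_3[of i] exhaust_3[of j] by (auto simp: c_def vec_eq_iff forall_3 mult.commute)
  then obtain u where u: "(\<Sum>k\<in>UNIV. h1$k * u$k) \<noteq> 0" "(\<Sum>k\<in>UNIV. h2$k * u$k) \<noteq> 0" "(\<Sum>k\<in>UNIV. c$k * u$k) \<noteq> 0"
    using ex_nonzero_of_three_forms[OF nz] by blast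
  have at: "endo_act (tensor v h) u = (\<Sum>k\<in>UNIV. h$k * u$k) *s v" for v h
    by (simp add: vec_eq_iff endo_act_nth sum_3 algebra_simps)
  have "det (triple (endo_act unit_endo u) (endo_act x u) (endo_act y u)) = 0"
    using ct by (intro comm_triple_det[OF ct]) (auto simp: comm_triple_def)
  moreover have "det (triple u (p *s u + q *s v1) (r *s u + t *s v2)) = q * t * (\<Sum>k\<in>UNIV. c$k * u$k)" for p q r t
    unfolding det_triple c_def by (simp add: sum_3 algebra_simps)
  ultimately show False
    using u by (simp add: x y endo_act_simps at)
qed

text \<open>Transposition exchanges \<open>v\<close> and \<open>h\<close> in
  \<open>tensor v h\<close>, so what holds for the vectors carries over to the forms.\<close>

lemma comm_triple_transpose:
  assumes "comm_triple x y w" shows "comm_triple (endo_transpose x) (endo_transpose y) (endo_transpose w)"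
proof -
  have "a *s x + b *s y + c *s w = 0" if "a *s endo_transpose x + b *s endo_transpose y + c *s endo_transpose w = 0" for a b c
    using arg_cong[OF that, of endo_transpose] by (simp add: endo_transpose_simps)
  then show ?thesis
    using assms unfolding comm_triple_def fam_indep_triple by (simp add: endo_transpose_simps) blast
qed

text \<open>The rank-one parts of \<open>x\<close> and \<open>y\<close> have proportional vectors
  and, by transposition, proportional forms. Hence \<open>unit_endo, x, y\<close> would be
  dependent.\<close>

lemma no_comm_triple: "\<not> comm_triple x y w"
proof
  assume ct: "comm_triple x y w"
  then have ct': "comm_triple y x w"
    unfolding comm_triple_def fam_indep_triple by (metis add.commute)
  obtain s1 v1 h1 where x: "x = s1 *s unit_endo + tensor v1 h1" by (rule comm_triple_rank_one[OF ct])
  obtain s2 v2 h2 where y: "y = s2 *s unit_endo + tensor v2 h2" by (rule comm_triple_rank_one[OF ct'])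
  have fi: "fam_indep (quad unit_endo x y w)"
    using ct fam_indep_triple_unit_endo by (auto simp: comm_triple_def)
  have ind: "a = 0 \<and> b = 0" if "c *s unit_endo + a *s x + b *s y = 0" for a b c
  proof -
    have "(\<Sum>k\<in>UNIV. (quad c a b 0 $ k) *s quad unit_endo x y w $ k) = 0" using that by (simp add: sum_4)
    then have "\<forall>k. quad c a b 0 $ k = 0"
      using fi[unfolded fam_indep_def, THEN spec, of "\<lambda>k. quad c a b 0 $ k"] by blast
    then show ?thesis unfolding forall_4 by simp
  qed
  have nx: "tensor v1 h1 \<noteq> 0" using ind[of "- s1" 1 0] by (auto simp: x)
  have ny: "tensor v2 h2 \<noteq> 0" using ind[of "- s2" 0 1] by (auto simp: y)
  have nz: "v1 \<noteq> 0" "h1 \<noteq> 0" "v2 \<noteq> 0" "h2 \<noteq> 0"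
    using nx ny by (auto simp: vec_eq_iff)
  have pv: "v1 $ i * v2 $ j = v1 $ j * v2 $ i" for i j
    by (rule comm_triple_parallel[OF ct x y]) (use nz in auto)
  have ph: "h1 $ i * h2 $ j = h1 $ j * h2 $ i" for i j
    by (rule comm_triple_parallel[OF comm_triple_transpose[OF ct], of s1 h1 v1 s2 h2 v2])
      (use nz in \<open>auto simp: x y endo_transpose_simps\<close>)
  from ny obtain p where p: "tensor v2 h2 $ p \<noteq> 0" by (metis vec_eq_iff zero_index)
  have "tensor v2 h2 $ p *s tensor v1 h1 = tensor v1 h1 $ p *s tensor v2 h2"
  proof -
    have "v2 $ i * h2 $ j * (v1 $ k * h1 $ l) = v1 $ i * h1 $ j * (v2 $ k * h2 $ l)" for i j k l
      using pv[of k i] ph[of l j] by algebra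
    then show ?thesis by (cases p) (simp add: vec_eq_iff)
  qed
  then have "(tensor v1 h1 $ p * s2 - tensor v2 h2 $ p * s1) *s unit_endo + tensor v2 h2 $ p *s x + (- tensor v1 h1 $ p) *s y = 0"
    by (simp add: x y vec_eq_iff algebra_simps)
  then show False using ind p by blast
qed

section \<open>Abelian bivectors\<close>

definition wedge2 :: "complex ^ 'n \<Rightarrow> complex ^ 'n \<Rightarrow> complex ^ ('n ^ 2)" where
  "wedge2 u v = wedge (pair u v)"

definition wedge3 :: "complex ^ 'n \<Rightarrow> complex ^ 'n \<Rightarrow> complex ^ 'n \<Rightarrow> complex ^ ('n ^ 3)" where
  "wedge3 u v w = wedge (triple u v w)"

lemma wedge2_component: "wedge2 u v $ J = u $ (J $ 1) * v $ (J $ 2) - u $ (J $ 2) * v $ (J $ 1)"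
  by (simp add: wedge2_def wedge_def det_2)

lemma wedge2_nth [simp]: "wedge2 u v $ pair s t = u $ s * v $ t - u $ t * v $ s"
  by (simp add: wedge2_component)

lemma wedge2_simps:
  "wedge2 (a + b) c = wedge2 a c + wedge2 b c" "wedge2 c (a + b) = wedge2 c a + wedge2 c b"
  "wedge2 (k *s a) c = k *s wedge2 a c" "wedge2 c (k *s a) = k *s wedge2 c a"
  "wedge2 a a = 0" "wedge2 0 a = 0" "wedge2 a 0 = 0"
  "wedge2 (a - b) c = wedge2 a c - wedge2 b c" "wedge2 c (a - b) = wedge2 c a - wedge2 c b"
  by (simp_all add: vec_eq_iff wedge2_component algebra_simps)

lemma fam_indep_pair: "fam_indep (pair x y) \<longleftrightarrow> (\<forall>a b. a *s x + b *s y = 0 \<longrightarrow> a = 0 \<and> b = 0)"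
proof
  assume f: "fam_indep (pair x y)"
  show "\<forall>a b. a *s x + b *s y = 0 \<longrightarrow> a = 0 \<and> b = 0"
  proof (intro allI impI)
    fix a b assume "a *s x + b *s y = 0"
    then show "a = 0 \<and> b = 0"
      using f[unfolded fam_indep_def, THEN spec, of "\<lambda>k. pair a b $ k"] by (simp add: sum_2 forall_2)
  qed
qed (auto simp: fam_indep_def sum_2 forall_2)

lemma wedge2_nonzero_iff: "wedge2 x y \<noteq> 0 \<longleftrightarrow> (\<forall>a b. a *s x + b *s y = 0 \<longrightarrow> a = 0 \<and> b = 0)"
  unfolding wedge2_def wedge_nonzero_iff fam_indep_pair ..

lemma wedge2_zeroD:
  assumes "wedge2 x y = 0" "x \<noteq> 0" obtains c where "y = c *s x"
proof -
  obtain a b where ab: "a *s x + b *s y = 0" "a \<noteq> 0 \<or> b \<noteq> 0"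
    using wedge2_nonzero_iff[of x y] assms(1) by blast
  then have b: "b \<noteq> 0" using assms(2) by auto
  have "a * x $ i + b * y $ i = 0" for i
    using arg_cong[OF ab(1), of "\<lambda>v. v $ i"] by simp
  then have "b * y $ i = - a * x $ i" for i by (simp add: eq_neg_iff_add_eq_0 add.commute)
  then have "y $ i = (- a / b) * x $ i" for i using b by (simp add: field_simps)
  then have "y = (- a / b) *s x" by (simp add: vec_eq_iff)
  then show thesis by (rule that)
qed

text \<open>Contractions on \<open>\<Lambda>\<^sup>2\<close> that detect, for \<open>a \<and> b\<close>, the commutator of \<open>a, b\<close> and their traces.\<close>

definition commutator_form :: "complex ^ ((3 \<times> 3) ^ 2) \<Rightarrow> complex ^ (3 \<times> 3)" where
  "commutator_form w = (\<chi> p. \<Sum>j\<in>UNIV. w $ pair (fst p, j) (j, snd p))"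

definition trace_form :: "complex ^ ((3 \<times> 3) ^ 2) \<Rightarrow> complex ^ (3 \<times> 3)" where
  "trace_form w = (\<chi> t. \<Sum>i\<in>UNIV. w $ pair (i, i) t)"

lemma commutator_form_wedge2: "commutator_form (wedge2 a b) = endo_mul a b - endo_mul b a"
  by (simp add: vec_eq_iff commutator_form_def endo_mul_def sum_subtractf mult.commute)

lemma trace_form_wedge2: "trace_form (wedge2 a b) = endo_trace a *s b - endo_trace b *s a"
  by (simp add: vec_eq_iff trace_form_def endo_trace_def sum_subtractf sum_distrib_left sum_distrib_right mult.commute)

text \<open>The affine cone over \<open>Y\<close>. It contains 0, so that all vectors of a subspace
  can be tested alike.\<close>

definition abelian_bivector :: "complex ^ ((3 \<times> 3) ^ 2) \<Rightarrow> bool" where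
  "abelian_bivector w \<longleftrightarrow> (\<exists>a b. w = wedge2 a b \<and> endo_trace a = 0 \<and> endo_trace b = 0 \<and> endo_mul a b = endo_mul b a)"

text \<open>Both contractions depend only on the bivector and vanish for a commuting traceless pair.
  Independence of \<open>a, b\<close> then separates the two traces.\<close>

lemma abelian_bivector_wedge2:
  assumes "abelian_bivector (wedge2 a b)" "wedge2 a b \<noteq> 0"
  shows "endo_trace a = 0" "endo_trace b = 0" "endo_mul a b = endo_mul b a"
proof -
  obtain c d where cd: "wedge2 a b = wedge2 c d" "endo_trace c = 0" "endo_trace d = 0" "endo_mul c d = endo_mul d c"
    using assms(1) abelian_bivector_def by blast
  have "endo_trace a *s b + (- endo_trace b) *s a = 0"
    using trace_form_wedge2[of a b] trace_form_wedge2[of c d] cd by simp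
  then show "endo_trace a = 0" "endo_trace b = 0"
    using assms(2) unfolding wedge2_nonzero_iff by (metis add.commute neg_equal_0_iff_equal)+
  show "endo_mul a b = endo_mul b a"
    using commutator_form_wedge2[of a b] commutator_form_wedge2[of c d] cd by simp
qed

lemma line_in_Y_iff:
  assumes "w \<noteq> 0" shows "vec.span {w} \<in> Y \<longleftrightarrow> abelian_bivector w"
proof
  assume "vec.span {w} \<in> Y"
  then obtain A where A: "A \<in> abelian_planes" "vec.span {w} = exterior_power A"
    by (auto simp: Y_def pluecker_def)
  then have A': "vec.subspace A" "A \<subseteq> sl_W" "vec.dim A = CARD(2)"
    "\<forall>x\<in>A. \<forall>y\<in>A. endo_mul x y = endo_mul y x"
    by (simp_all add: abelian_planes_def Gr_def endo_matrix_commute)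
  obtain p :: "complex ^ (3 \<times> 3) ^ 2" where p: "A = span_fam p"
    by (rule subspace_eq_span_fam[OF A'(1,3)])
  have "w \<in> vec.span {wedge p}"
    using A(2) vec.span_base[of w "{w}"] unfolding p exterior_power_span_fam by simp
  then obtain c where "w = c *s wedge p" using in_span_singleton by blast
  then have w: "w = wedge2 (c *s p $ 1) (p $ 2)"
    by (simp add: wedge2_simps) (simp add: wedge2_def pair_eta)
  have m: "c *s p $ 1 \<in> A" "p $ 2 \<in> A" by (auto simp: p intro: vec.span_scale vec.span_base)
  show "abelian_bivector w"
    unfolding abelian_bivector_def using w m A' sl_W_iff by blast
next
  assume "abelian_bivector w"
  then obtain a b where ab: "w = wedge2 a b" "endo_trace a = 0" "endo_trace b = 0" "endo_mul a b = endo_mul b a"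
    unfolding abelian_bivector_def by blast
  let ?A = "span_fam (pair a b)"
  have fi: "fam_indep (pair a b)" using assms ab(1) wedge_nonzero_iff wedge2_def by metis
  have el: "\<exists>p q. x = p *s a + q *s b" if "x \<in> ?A" for x
    using that unfolding in_span_fam sum_2 by auto
  have "?A \<subseteq> sl_W"
    using el ab by (fastforce simp: sl_W_iff endo_trace_simps)
  moreover have "endo_mul x y = endo_mul y x" if xy: "x \<in> ?A" "y \<in> ?A" for x y
  proof -
    obtain p q r s where "x = p *s a + q *s b" "y = r *s a + s *s b" using el xy by metis
    then show ?thesis
      by (simp add: endo_mul_simps vector_smult_assoc vec.scale_right_distrib ab(4) mult.commute add_ac)
  qed
  ultimately have "?A \<in> abelian_planes"
    using dim_span_fam[OF fi] by (simp add: abelian_planes_def Gr_def endo_matrix_commute)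
  moreover have "exterior_power ?A = vec.span {w}"
    unfolding exterior_power_span_fam ab(1) wedge2_def ..
  ultimately show "vec.span {w} \<in> Y" by (auto simp: Y_def pluecker_def image_iff)
qed

text \<open>Abelian bivectors lie in the exterior square of \<open>sl_W\<close> anyway, so only a
  condition on each vector of \<open>E\<close> remains.\<close>

lemma planes_in_Y_iff:
  "E \<in> planes_in_Y \<longleftrightarrow> vec.subspace E \<and> vec.dim E = 3 \<and> (\<forall>w\<in>E. abelian_bivector w)"
proof -
  have 0: "abelian_bivector 0"
    unfolding abelian_bivector_def by (intro exI[of _ 0]) (simp add: wedge2_simps endo_trace_simps)
  have "E \<subseteq> exterior_power sl_W" if E: "\<forall>w\<in>E. abelian_bivector w"
  proof
    fix w assume "w \<in> E"
    then obtain a b where ab: "w = wedge2 a b" "endo_trace a = 0" "endo_trace b = 0"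
      using E abelian_bivector_def by blast
    then show "w \<in> exterior_power sl_W"
      unfolding exterior_power_def
      by (intro vec.span_base CollectI exI[of _ "pair a b"]) (simp add: wedge2_def forall_2 sl_W_iff)
  qed
  moreover have "proj E \<subseteq> Y \<longleftrightarrow> (\<forall>w\<in>E. abelian_bivector w)" if E: "vec.subspace E"
  proof
    assume p: "proj E \<subseteq> Y"
    show "\<forall>w\<in>E. abelian_bivector w"
    proof
      fix w assume w: "w \<in> E"
      show "abelian_bivector w"
      proof (cases "w = 0")
        case False
        then have "vec.span {w} \<in> proj E" using E w by (auto simp: proj_def Gr_def vec.span_minimal)
        then show ?thesis using line_in_Y_iff False p by blast
      qed (use 0 in simp)
    qed
  next
    assume ab: "\<forall>w\<in>E. abelian_bivector w"
    show "proj E \<subseteq> Y"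
    proof
      fix L assume L: "L \<in> proj E"
      then have "L \<in> proj UNIV" "L \<subseteq> E" by (auto simp: proj_def Gr_def)
      then obtain w where w: "w \<noteq> 0" "L = vec.span {w}" "w \<in> E"
        using proj_UNIV_iff[of L] vec.span_base by blast
      then show "L \<in> Y" using line_in_Y_iff ab by blast
    qed
  qed
  ultimately show ?thesis unfolding planes_in_Y_def Gr_def by blast
qed

section \<open>Bivectors with decomposable sum\<close>

lemma dual_functionals:
  fixes q :: "complex ^ 'n ^ 'k"
  assumes "fam_indep q"
  obtains B :: "complex ^ 'k ^ 'n" where "\<And>a b. (\<Sum>j\<in>UNIV. q $ a $ j * B $ j $ b) = (if a = b then 1 else 0)"
proof -
  \<comment> \<open>The columns of a right inverse are functionals dual to the rows of
    \<open>q\<close>.\<close>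
  have "\<exists>B. q ** B = mat 1"
    using assms unfolding matrix_right_invertible_independent_rows by (simp add: fam_indep_def row_def)
  then obtain B where B: "q ** B = mat 1" by blast
  have "(\<Sum>j\<in>UNIV. q $ a $ j * B $ j $ b) = (if a = b then 1 else 0)" for a b
    using arg_cong[OF B, of "\<lambda>M. M $ a $ b"] by (simp add: matrix_matrix_mult_def mat_def)
  then show thesis by (rule that)
qed

definition pairing :: "complex ^ 'n \<Rightarrow> (complex ^ 'k ^ 'n) \<Rightarrow> 'k \<Rightarrow> complex" where
  "pairing x B k = (\<Sum>j\<in>UNIV. x $ j * B $ j $ k)"

text \<open>The tensor product of functionals \<open>k\<close> and \<open>l\<close>. It takes the
  tensor itself as argument, so that an equation between bivectors can be evaluated on both
  sides.\<close>

definition pairing2 :: "complex ^ ('n ^ 2) \<Rightarrow> (complex ^ 'k ^ 'n) \<Rightarrow> 'k \<Rightarrow> 'k \<Rightarrow> complex" where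
  "pairing2 w B k l = (\<Sum>s\<in>UNIV. \<Sum>t\<in>UNIV. w $ pair s t * (B $ s $ k * B $ t $ l))"

lemma pairing2_wedge2:
  "pairing2 (wedge2 x y) B k l = pairing x B k * pairing y B l - pairing x B l * pairing y B k"
proof -
  have "pairing x B k * pairing y B l = (\<Sum>s\<in>UNIV. \<Sum>t\<in>UNIV. x $ s * y $ t * (B $ s $ k * B $ t $ l))"
    unfolding pairing_def sum_product by (simp add: mult_ac)
  moreover have "pairing x B l * pairing y B k = (\<Sum>s\<in>UNIV. \<Sum>t\<in>UNIV. x $ t * y $ s * (B $ s $ k * B $ t $ l))"
    unfolding pairing_def sum_product by (subst sum.swap) (simp add: mult_ac)
  ultimately show ?thesis
    by (simp add: pairing2_def left_diff_distrib sum_subtractf)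
qed

lemma pairing2_add: "pairing2 (u + w) B k l = pairing2 u B k l + pairing2 w B k l"
  by (simp add: pairing2_def distrib_right sum.distrib)

lemma fam_indep_quad:
  "fam_indep (quad x y w t) \<longleftrightarrow>
    (\<forall>a b c d. a *s x + b *s y + c *s w + d *s t = 0 \<longrightarrow> a = 0 \<and> b = 0 \<and> c = 0 \<and> d = 0)"
proof
  assume f: "fam_indep (quad x y w t)"
  show "\<forall>a b c d. a *s x + b *s y + c *s w + d *s t = 0 \<longrightarrow> a = 0 \<and> b = 0 \<and> c = 0 \<and> d = 0"
  proof (intro allI impI)
    fix a b c d assume "a *s x + b *s y + c *s w + d *s t = 0"
    then show "a = 0 \<and> b = 0 \<and> c = 0 \<and> d = 0"
      using f[unfolded fam_indep_def, THEN spec, of "\<lambda>k. quad a b c d $ k"] by (simp add: sum_4 forall_4)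
  qed
qed (auto simp: fam_indep_def sum_4 forall_4)

text \<open>Four independent vectors would make the left side a bivector of rank four; dual
  functionals compute its coordinates.\<close>

lemma wedge2_sum_decomposable:
  assumes "wedge2 a b + wedge2 c d = wedge2 e f"
  shows "\<not> fam_indep (quad a b c d)"
proof
  assume "fam_indep (quad a b c d)"
  then obtain B where B: "\<And>k l. pairing (quad a b c d $ k) B l = (if k = l then 1 else 0)"
    using dual_functionals unfolding pairing_def by blast
  have p: "pairing a B l = (if 1 = l then 1 else 0)" "pairing b B l = (if 2 = l then 1 else 0)"
    "pairing c B l = (if 3 = l then 1 else 0)" "pairing d B l = (if 4 = l then 1 else 0)" for l
    using B[of 1 l] B[of 2 l] B[of 3 l] B[of 4 l] by simp_all
  define E F where "E = pairing e B" and "F = pairing f B"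
  have "pairing2 (wedge2 a b) B k l + pairing2 (wedge2 c d) B k l = E k * F l - E l * F k" for k l
    unfolding pairing2_add[symmetric] assms by (simp add: pairing2_wedge2 E_def F_def)
  from this[of 1 2] this[of 3 4] this[of 1 3] this[of 2 4] this[of 1 4] this[of 2 3]
  have "E 1 * F 2 - E 2 * F 1 = 1" "E 3 * F 4 - E 4 * F 3 = 1" "E 1 * F 3 - E 3 * F 1 = 0"
    "E 2 * F 4 - E 4 * F 2 = 0" "E 1 * F 4 - E 4 * F 1 = 0" "E 2 * F 3 - E 3 * F 2 = 0"
    by (simp_all add: pairing2_wedge2 p)
  \<comment> \<open>These values violate the Pluecker relation of \<open>e \<and> f\<close>.\<close>
  then show False by algebra
qed

text \<open>If \<open>x, y, x'\<close> were independent, functionals dual to \<open>x, y\<close> and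
  zero on \<open>x'\<close> would give 1 on one side and 0 on the other.\<close>

lemma wedge2_eq_mem:
  assumes "wedge2 x y = wedge2 x' y'" "wedge2 x y \<noteq> 0"
  obtains p q where "x' = p *s x + q *s y"
proof -
  have "\<not> fam_indep (triple x y x')"
  proof
    assume "fam_indep (triple x y x')"
    then obtain B where B: "\<And>k l. pairing (triple x y x' $ k) B l = (if k = l then 1 else 0)"
      using dual_functionals unfolding pairing_def by blast
    have "pairing x B 1 = 1" "pairing x B 2 = 0" "pairing y B 1 = 0" "pairing y B 2 = 1"
      "pairing x' B 1 = 0" "pairing x' B 2 = 0"
      using B[of 1 1] B[of 1 2] B[of 2 1] B[of 2 2] B[of 3 1] B[of 3 2] by simp_all
    then show False
      using arg_cong[OF assms(1), of "\<lambda>w. pairing2 w B 1 2"] by (simp add: pairing2_wedge2)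
  qed
  then obtain a b c where abc: "a *s x + b *s y + c *s x' = 0" "a \<noteq> 0 \<or> b \<noteq> 0 \<or> c \<noteq> 0"
    unfolding fam_indep_triple by blast
  then have c: "c \<noteq> 0" using assms(2) unfolding wedge2_nonzero_iff by auto
  have rel: "a * x $ i + b * y $ i + c * x' $ i = 0" for i
    using arg_cong[OF abc(1), of "\<lambda>v. v $ i"] by simp
  have "c * x' $ i = - a * x $ i - b * y $ i" for i using rel[of i] by algebra
  then have "x' $ i = (- a / c) * x $ i + (- b / c) * y $ i" for i using c by (simp add: field_simps)
  then have "x' = (- a / c) *s x + (- b / c) *s y" by (simp add: vec_eq_iff)
  then show thesis by (rule that)
qed

text \<open>The vector is completed to a pair of determinant one in terms of
  \<open>a, b\<close>.\<close>

lemma wedge2_factor: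
  assumes "p *s a + q *s b \<noteq> 0"
  obtains y where "wedge2 a b = wedge2 (p *s a + q *s b) y"
proof (cases "p = 0")
  case False
  have "wedge2 a b = wedge2 (p *s a + q *s b) ((1 / p) *s b)" using False by (simp add: wedge2_simps)
  then show thesis by (rule that)
next
  case True
  then have q: "q \<noteq> 0" using assms by auto
  have "wedge2 a b = wedge2 (p *s a + q *s b) ((- 1 / q) *s a)"
    using q True by (simp add: vec_eq_iff wedge2_component)
  then show thesis by (rule that)
qed

text \<open>A linear relation among \<open>a, b, c, d\<close> yields a vector common to both planes,
  nonzero because each pair is independent. It can be split off from both bivectors.\<close>

lemma wedge2_common_factor:
  assumes "wedge2 a b + wedge2 c d = wedge2 e f" "wedge2 a b \<noteq> 0" "wedge2 c d \<noteq> 0"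
  obtains x y1 y2 where "wedge2 a b = wedge2 x y1" "wedge2 c d = wedge2 x y2"
proof -
  obtain p q r s where s: "p *s a + q *s b + r *s c + s *s d = 0" "p \<noteq> 0 \<or> q \<noteq> 0 \<or> r \<noteq> 0 \<or> s \<noteq> 0"
    using wedge2_sum_decomposable[OF assms(1)] unfolding fam_indep_quad by blast
  define x where "x = p *s a + q *s b"
  have x': "x = (- r) *s c + (- s) *s d"
  proof -
    have "x + (r *s c + s *s d) = 0" using s(1) by (simp add: x_def add.assoc)
    then have "x = - (r *s c + s *s d)" by (simp only: eq_neg_iff_add_eq_0)
    then show ?thesis by (simp add: vec.scale_minus_left)
  qed
  have "x \<noteq> 0"
  proof
    assume x0: "x = 0"
    have "p = 0 \<and> q = 0" using x0 assms(2) unfolding wedge2_nonzero_iff x_def by blast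
    moreover have "- r = 0 \<and> - s = 0" using x0 assms(3) unfolding wedge2_nonzero_iff x' by blast
    ultimately show False using s(2) by auto
  qed
  obtain y1 where y1: "wedge2 a b = wedge2 x y1"
    using wedge2_factor[of p a q b] \<open>x \<noteq> 0\<close> unfolding x_def by blast
  obtain y2 where y2: "wedge2 c d = wedge2 x y2"
    using wedge2_factor[of "- r" c "- s" d] \<open>x \<noteq> 0\<close> unfolding x' by blast
  show thesis by (rule that[OF y1 y2])
qed

lemma wedge2_independent_factors:
  assumes "\<And>p q. p *s wedge2 x y + q *s wedge2 x z = 0 \<Longrightarrow> p = 0 \<and> q = 0"
  shows "fam_indep (triple x y z)"
  unfolding fam_indep_triple
proof (intro allI impI)
  fix a b c assume s: "a *s x + b *s y + c *s z = 0"
  have "b *s wedge2 x y + c *s wedge2 x z = 0"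
    using arg_cong[OF s, of "wedge2 x"] by (simp add: wedge2_simps)
  then have bc: "b = 0" "c = 0" using assms by auto
  have "x \<noteq> 0" using assms[of 1 0] by (auto simp: wedge2_simps)
  then show "a = 0 \<and> b = 0 \<and> c = 0" using s bc by simp
qed

text \<open>Sums of two of the bivectors are decomposable, so their planes meet pairwise. Either a
  common vector of two planes lies in the third, or the three common vectors are independent,
  commuting and traceless, which \<open>no_comm_triple\<close> excludes.\<close>

lemma pencil_of_bivectors:
  assumes fi: "fam_indep (triple w1 w2 w3)"
    and ab: "\<And>a b c. abelian_bivector (a *s w1 + b *s w2 + c *s w3)"
  obtains x y1 y2 y3 where "w1 = wedge2 x y1" "w2 = wedge2 x y2" "w3 = wedge2 x y3"
proof -
  have ind: "a *s w1 + b *s w2 + c *s w3 = 0 \<Longrightarrow> a = 0 \<and> b = 0 \<and> c = 0" for a b c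
    using fi unfolding fam_indep_triple by blast
  have ab1: "abelian_bivector w1" "abelian_bivector w2" "abelian_bivector w3"
    "abelian_bivector (w1 + w2)" "abelian_bivector (w1 + w3)" "abelian_bivector (w2 + w3)"
    using ab[of 1 0 0] ab[of 0 1 0] ab[of 0 0 1] ab[of 1 1 0] ab[of 1 0 1] ab[of 0 1 1] by simp_all
  have nz: "w1 \<noteq> 0" "w2 \<noteq> 0" "w3 \<noteq> 0"
    using ind[of 1 0 0] ind[of 0 1 0] ind[of 0 0 1] by auto
  have common: "\<exists>x y1 y2. u = wedge2 x y1 \<and> w = wedge2 x y2"
    if uw: "abelian_bivector u" "abelian_bivector w" "abelian_bivector (u + w)" "u \<noteq> 0" "w \<noteq> 0" for u w

  proof -
    obtain a b c d e f where "u = wedge2 a b" "w = wedge2 c d" "u + w = wedge2 e f"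
      using uw(1-3) unfolding abelian_bivector_def by blast
    then show ?thesis using wedge2_common_factor[of a b c d e f] uw(4,5) by metis
  qed
  obtain x y1 y2 where x: "w1 = wedge2 x y1" "w2 = wedge2 x y2" using common ab1 nz by blast
  obtain x' z1 z3 where x': "w1 = wedge2 x' z1" "w3 = wedge2 x' z3" using common ab1 nz by blast
  obtain x'' v2 v3 where x'': "w2 = wedge2 x'' v2" "w3 = wedge2 x'' v3" using common ab1 nz by blast
  obtain p q where pq: "x' = p *s x + q *s y1" using wedge2_eq_mem[of x y1 x' z1] x x' nz by metis
  obtain r s where rs: "x'' = r *s x + s *s y2" using wedge2_eq_mem[of x y2 x'' v2] x x'' nz by metis
  obtain t g where tg: "x'' = t *s x' + g *s z3" using wedge2_eq_mem[of x' z3 x'' v3] x' x'' nz by metis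
  \<comment> \<open>\<open>q = 0\<close> or \<open>s = 0\<close> means that \<open>x'\<close> or
    \<open>x''\<close> is a multiple of \<open>x\<close>, which then also divides
    \<open>w3\<close>.\<close>
  show thesis
  proof (cases "q = 0 \<or> s = 0")
    case True
    have "\<exists>y. w3 = wedge2 x y"
    proof (cases "q = 0")
      case True
      then have "w3 = wedge2 x (p *s z3)" using x'(2) pq by (simp add: wedge2_simps)
      then show ?thesis ..
    next
      case False
      with True have "s = 0" by simp
      then have "w3 = wedge2 x (r *s v3)" using x''(2) rs by (simp add: wedge2_simps)
      then show ?thesis ..
    qed
    then show thesis using that x by blast
  next
    case False
    \<comment> \<open>Here the three bivectors span \<open>\<Lambda>\<^sup>2\<langle>x, x', x''\<rangle>\<close>, and \<open>x, x', x''\<close> commute.\<close>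
    have w1: "wedge2 x x' = q *s w1" by (simp add: pq x(1) wedge2_simps)
    have w2: "wedge2 x x'' = s *s w2" by (simp add: rs x(2) wedge2_simps)
    have w3: "wedge2 x' x'' = g *s w3" by (simp add: tg x'(2) wedge2_simps)
    have fi3: "fam_indep (triple x x' x'')"
    proof (rule wedge2_independent_factors)
      fix a b assume "a *s wedge2 x x' + b *s wedge2 x x'' = 0"
      then have "(a * q) *s w1 + (b * s) *s w2 + 0 *s w3 = 0" by (simp add: w1 w2)
      then show "a = 0 \<and> b = 0" using ind False by fastforce
    qed
    have n3: "wedge2 x' x'' \<noteq> 0"
      unfolding wedge2_nonzero_iff
    proof (intro allI impI)
      fix a b assume "a *s x' + b *s x'' = 0"
      then have "0 *s x + a *s x' + b *s x'' = 0" by simp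
      then show "a = 0 \<and> b = 0" using fi3 unfolding fam_indep_triple by blast
    qed
    have n12: "wedge2 x x' \<noteq> 0" "wedge2 x x'' \<noteq> 0" using w1 w2 False nz by simp_all
    have "abelian_bivector (wedge2 x x')" "abelian_bivector (wedge2 x x'')" "abelian_bivector (wedge2 x' x'')"
      unfolding w1 w2 w3 using ab[of q 0 0] ab[of 0 s 0] ab[of 0 0 g] by simp_all
    note ab3 = this
    have "comm_triple x x' x''"
      unfolding comm_triple_def
      using abelian_bivector_wedge2[OF ab3(1) n12(1)] abelian_bivector_wedge2[OF ab3(2) n12(2)]
        abelian_bivector_wedge2[OF ab3(3) n3] fi3 by blast
    then show thesis using no_comm_triple by blast
  qed
qed

section \<open>Classification of the planes\<close>

definition traceless_part :: "complex ^ (3 \<times> 3) \<Rightarrow> complex ^ (3 \<times> 3)" where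
  "traceless_part z = z - (endo_trace z / 3) *s unit_endo"

definition plane_of :: "complex ^ (3 \<times> 3) \<Rightarrow> (complex ^ ((3 \<times> 3) ^ 2)) set" where
  "plane_of z = {wedge2 (traceless_part z) y | y. endo_trace y = 0 \<and> endo_mul z y = endo_mul y z}"

lemma traceless_part_simps:
  "traceless_part (a + b) = traceless_part a + traceless_part b"
  "traceless_part (a - b) = traceless_part a - traceless_part b"
  "traceless_part (c *s a) = c *s traceless_part a"
  "endo_trace (traceless_part a) = 0"
  "traceless_part unit_endo = 0" "traceless_part 0 = 0"
  by (simp_all add: traceless_part_def endo_trace_simps vec_eq_iff algebra_simps add_divide_distrib diff_divide_distrib)

lemma traceless_part_traceless: "endo_trace y = 0 \<Longrightarrow> traceless_part y = y"
  by (simp add: traceless_part_def)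

lemma endo_mul_traceless_part_commute: "endo_mul (traceless_part z) y = endo_mul y (traceless_part z) \<longleftrightarrow> endo_mul z y = endo_mul y z"
  by (simp add: traceless_part_def endo_mul_simps)

lemma subspace_plane_of: "vec.subspace (plane_of z)"
proof (rule vec.subspaceI)
  show "0 \<in> plane_of z"
    unfolding plane_of_def by (intro CollectI exI[of _ 0]) (simp add: wedge2_simps endo_trace_simps endo_mul_simps)
next
  fix x y assume "x \<in> plane_of z" "y \<in> plane_of z"
  then obtain a b where "x = wedge2 (traceless_part z) a" "endo_trace a = 0" "endo_mul z a = endo_mul a z"
    "y = wedge2 (traceless_part z) b" "endo_trace b = 0" "endo_mul z b = endo_mul b z" unfolding plane_of_def by blast
  then show "x + y \<in> plane_of z"
    unfolding plane_of_def by (intro CollectI exI[of _ "a + b"]) (simp add: wedge2_simps endo_trace_simps endo_mul_simps)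
next
  fix c x assume "x \<in> plane_of z"
  then obtain a where "x = wedge2 (traceless_part z) a" "endo_trace a = 0" "endo_mul z a = endo_mul a z" unfolding plane_of_def by blast
  then show "c *s x \<in> plane_of z"
    unfolding plane_of_def by (intro CollectI exI[of _ "c *s a"]) (simp add: wedge2_simps endo_trace_simps endo_mul_simps)
qed

lemma abelian_bivector_plane_of:
  assumes "w \<in> plane_of z" shows "abelian_bivector w"
proof -
  obtain y where "w = wedge2 (traceless_part z) y" "endo_trace y = 0" "endo_mul z y = endo_mul y z" using assms plane_of_def by blast
  then show ?thesis
    unfolding abelian_bivector_def by (intro exI[of _ "traceless_part z"] exI[of _ y]) (simp add: traceless_part_simps endo_mul_traceless_part_commute)
qed

section \<open>The annihilator of a rank-one matrix\<close>

definition annihilator :: "complex ^ (3 \<times> 3) \<Rightarrow> (complex ^ (3 \<times> 3)) set" where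
  "annihilator z = {a. endo_mul a z = 0 \<and> endo_mul z a = 0}"

lemma annihilator_simps:
  "a \<in> annihilator z \<Longrightarrow> b \<in> annihilator z \<Longrightarrow> a + b \<in> annihilator z"
  "a \<in> annihilator z \<Longrightarrow> b \<in> annihilator z \<Longrightarrow> a - b \<in> annihilator z"
  "a \<in> annihilator z \<Longrightarrow> c *s a \<in> annihilator z"
  by (simp_all add: annihilator_def endo_mul_simps)

text \<open>Polynomial sections of the annihilator of a matrix \<open>z\<close> of rank one; on the annihilator itself
  \<open>frame i l _ z\<close> is multiplication by the entry of \<open>z\<close> at \<open>(l, i)\<close>.\<close>

definition frame :: "3 \<Rightarrow> 3 \<Rightarrow> complex ^ (3 \<times> 3) \<Rightarrow> complex ^ (3 \<times> 3) \<Rightarrow> complex ^ (3 \<times> 3)" where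
  "frame i l c z = (\<chi> p. z $ (l, i) * c $ p
     - (if snd p = l then \<Sum>m\<in>UNIV. c $ (fst p, m) * z $ (m, i) else 0)
     - (if fst p = i then \<Sum>j\<in>UNIV. z $ (l, j) * c $ (j, snd p) else 0)
     + (if fst p = i \<and> snd p = l then \<Sum>j\<in>UNIV. \<Sum>m\<in>UNIV. c $ (j, m) * z $ (m, j) else 0))"

text \<open>Every correction term in \<open>frame\<close> is built from entries of
  \<open>a z\<close> or \<open>z a\<close>.\<close>

lemma frame_annihilator:
  assumes "a \<in> annihilator z" shows "frame i l a z = z $ (l, i) *s a"
proof -
  have 1: "(\<Sum>m\<in>UNIV. a $ (r, m) * z $ (m, s)) = 0" "(\<Sum>j\<in>UNIV. z $ (r, j) * a $ (j, s)) = 0" for r s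
    using assms by (simp_all add: annihilator_def flip: endo_mul_nth)
  have "(\<Sum>j\<in>UNIV. \<Sum>m\<in>UNIV. a $ (j, m) * z $ (m, j)) = 0" by (simp add: 1)
  then show ?thesis by (intro matrix_index_eqI) (simp add: frame_def 1)
qed

text \<open>For \<open>z = v h\<close>, with \<open>h\<close> and \<open>e_l\<close> as rows, the
  section is the product \<open>(h_i I - e_i h) c (v_l I - v e_l)\<close>. Its left factor is killed
  by \<open>h\<close>, and its right factor kills \<open>v\<close>.\<close>

lemma frame_in_annihilator: "frame i l c (tensor v h) \<in> annihilator (tensor v h)"
proof -
  have 1: "frame i l c (tensor v h) $ (r, 1) * v $ 1 + frame i l c (tensor v h) $ (r, 2) * v $ 2 + frame i l c (tensor v h) $ (r, 3) * v $ 3 = 0" for r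
    using exhaust_3[of l] by (cases "r = i") (auto simp: frame_def sum_3 algebra_simps)
  have 2: "h $ 1 * frame i l c (tensor v h) $ (1, s) + h $ 2 * frame i l c (tensor v h) $ (2, s) + h $ 3 * frame i l c (tensor v h) $ (3, s) = 0" for s
    using exhaust_3[of i] by (cases "s = l") (auto simp: frame_def sum_3 algebra_simps)
  have "endo_mul (frame i l c (tensor v h)) (tensor v h) $ (r, s) = 0" for r s
    using 1[of r] unfolding endo_mul_nth sum_3 tensor_nth by algebra
  moreover have "endo_mul (tensor v h) (frame i l c (tensor v h)) $ (r, s) = 0" for r s
    using 2[of s] unfolding endo_mul_nth sum_3 tensor_nth by algebra
  ultimately show ?thesis unfolding annihilator_def by (auto intro!: matrix_index_eqI)
qed

lemma frame_linear: "frame i l (a + b) z = frame i l a z + frame i l b z" "frame i l (c *s a) z = c *s frame i l a z"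
  by (auto intro!: matrix_index_eqI simp: frame_def sum_3 algebra_simps)

lemma frame_axis:
  "frame i l (axis (r, s) 1) z $ (r', s') = (if r' = r \<and> s' = s then z $ (l, i) else 0)
     - (if s' = l \<and> r' = r then z $ (s, i) else 0) - (if r' = i \<and> s' = s then z $ (l, r) else 0)
     + (if r' = i \<and> s' = l then z $ (s, r) else 0)"
proof -
  let ?e = "axis (r, s) 1 :: complex ^ (3 \<times> 3)"
  have e: "?e $ (a, b) = (if b = s then if a = r then 1 else 0 else 0)" for a b
    by (simp add: axis_def)
  have e': "?e $ (a, b) = (if a = r then if b = s then 1 else 0 else 0)" for a b
    by (simp add: axis_def)
  have 1: "(\<Sum>m\<in>UNIV. ?e $ (a, m) * z $ (m, b)) = (if a = r then z $ (s, b) else 0)" for a b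
    by (simp add: e if_distrib[of "\<lambda>c. c * _"] cong: if_cong)
  have 2: "(\<Sum>j\<in>UNIV. z $ (a, j) * ?e $ (j, b)) = (if b = s then z $ (a, r) else 0)" for a b
    by (simp add: e' if_distrib[of "\<lambda>c. _ * c"] cong: if_cong)
  have 3: "(\<Sum>j\<in>UNIV. \<Sum>m\<in>UNIV. ?e $ (j, m) * z $ (m, j)) = z $ (s, r)"
    by (simp add: 1)
  show ?thesis
    by (simp only: frame_def vec_lambda_beta fst_conv snd_conv 1 2 3) (simp add: axis_def)
qed

lemma frame_axis_zero: "r = i \<or> s = l \<Longrightarrow> frame i l (axis (r, s) 1) z = 0"
  by (intro matrix_index_eqI) (auto simp: frame_axis)

text \<open>Elementary matrices in row \<open>i\<close> or column \<open>l\<close> have zero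
  section, so four sections generate all others.\<close>

lemma frame_expand:
  "frame i l c z = (\<Sum>r\<in>UNIV - {i}. \<Sum>s\<in>UNIV - {l}. c $ (r, s) *s frame i l (axis (r, s) 1) z)"
proof -
  have "frame i l (\<Sum>p\<in>S. f p *s g p) z = (\<Sum>p\<in>S. f p *s frame i l (g p) z)" for S f g
    by (induction S rule: infinite_finite_induct) (auto simp: frame_linear frame_linear(2)[of _ _ 0 0, simplified])
  moreover have "c = (\<Sum>p\<in>UNIV. c $ p *s axis p 1)"
    by (simp add: vec_eq_iff axis_def if_distrib[of "\<lambda>x. _ * x"] cong: if_cong)
  ultimately have "frame i l c z = (\<Sum>p\<in>UNIV. c $ p *s frame i l (axis p 1) z)" by metis
  also have "\<dots> = (\<Sum>p\<in>(UNIV - {i}) \<times> (UNIV - {l}). c $ p *s frame i l (axis p 1) z)"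
    by (rule sum.mono_neutral_right) (auto simp: frame_axis_zero)
  also have "\<dots> = (\<Sum>r\<in>UNIV - {i}. \<Sum>s\<in>UNIV - {l}. c $ (r, s) *s frame i l (axis (r, s) 1) z)"
    by (simp add: sum.cartesian_product split_def)
  finally show ?thesis .
qed

lemma tensor_square: "endo_mul (tensor v h) (tensor v h) = endo_trace (tensor v h) *s tensor v h"
  by (auto intro!: matrix_index_eqI simp: endo_mul_nth endo_trace_def sum_3 algebra_simps)

text \<open>That \<open>y\<close> commutes with \<open>v h\<close> means
  \<open>v (h y) = (y v) h\<close>: both \<open>v\<close> and \<open>h\<close> are eigenvectors of
  \<open>y\<close>, with the same eigenvalue \<open>c\<close>. Then \<open>y - c I\<close>
  annihilates \<open>v h\<close> on both sides and has the same traceless part as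
  \<open>y\<close>.\<close>

lemma plane_of_tensor:
  assumes "v \<noteq> 0" "h \<noteq> 0"
  shows "plane_of (tensor v h) = {wedge2 (traceless_part (tensor v h)) (traceless_part a) | a. a \<in> annihilator (tensor v h)}"
proof (intro equalityI subsetI)
  fix w assume "w \<in> plane_of (tensor v h)"
  then obtain y where w: "w = wedge2 (traceless_part (tensor v h)) y" and y: "endo_trace y = 0" "endo_mul (tensor v h) y = endo_mul y (tensor v h)"
    unfolding plane_of_def by blast
  from assms obtain l j where l: "v $ l \<noteq> 0" and j: "h $ j \<noteq> 0" by (metis vec_eq_iff zero_index)
  define yv where "yv i = (\<Sum>k\<in>UNIV. y $ (i, k) * v $ k)" for i
  define hy where "hy i = (\<Sum>k\<in>UNIV. h $ k * y $ (k, i))" for i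
  have "endo_mul (tensor v h) y $ (i, k) = v $ i * hy k" "endo_mul y (tensor v h) $ (i, k) = yv i * h $ k" for i k
    by (simp_all add: endo_mul_nth hy_def yv_def sum_3 algebra_simps)
  then have eq: "v $ i * hy k = yv i * h $ k" for i k using y(2) by metis
  define c where "c = hy j / h $ j"
  have yv: "yv i = c * v $ i" for i using eq[of i j] j by (simp add: c_def field_simps)
  have hy: "hy i = c * h $ i" for i
    using eq[of l i] yv[of l] l by (simp add: algebra_simps)
  have "y - c *s unit_endo \<in> annihilator (tensor v h)"
    using \<open>\<And>i k. endo_mul (tensor v h) y $ (i, k) = v $ i * hy k\<close> \<open>\<And>i k. endo_mul y (tensor v h) $ (i, k) = yv i * h $ k\<close>
    by (auto intro!: matrix_index_eqI simp: annihilator_def endo_mul_simps yv hy)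
  moreover have "traceless_part (y - c *s unit_endo) = y" using y by (simp add: traceless_part_simps traceless_part_traceless)
  ultimately show "w \<in> {wedge2 (traceless_part (tensor v h)) (traceless_part a) | a. a \<in> annihilator (tensor v h)}"
    using w by force
next
  fix w assume "w \<in> {wedge2 (traceless_part (tensor v h)) (traceless_part a) | a. a \<in> annihilator (tensor v h)}"
  then obtain a where "w = wedge2 (traceless_part (tensor v h)) (traceless_part a)" "a \<in> annihilator (tensor v h)" by blast
  then show "w \<in> plane_of (tensor v h)"
    unfolding plane_of_def annihilator_def
    by (intro CollectI exI[of _ "traceless_part a"]) (auto simp: traceless_part_simps, simp add: traceless_part_def endo_mul_simps)
qed

lemma UNIV_diff_three:
  fixes f :: "3 \<Rightarrow> 'a :: comm_monoid_add"
  assumes "UNIV = {i, j, k}" "j \<noteq> i" "k \<noteq> i" "j \<noteq> k"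
  shows "(\<Sum>r\<in>UNIV - {i}. f r) = f j + f k"
proof -
  have "UNIV - {i} = {j, k}" using assms by auto
  then show ?thesis using assms by simp
qed

lemma tensor_neq_scalar:
  assumes "v \<noteq> 0" "h \<noteq> (0 :: complex ^ 3)" shows "tensor v h \<noteq> t *s unit_endo"
proof
  assume eq: "tensor v h = t *s unit_endo"
  have e: "v $ i * h $ j = (if i = j then t else 0)" for i j
    using arg_cong[OF eq, of "\<lambda>x. x $ (i, j)"] by simp
  \<comment> \<open>A 2x2 minor of the rank-one matrix gives \<open>t^2 = 0\<close>.\<close>
  have "t * t = (v $ 1 * h $ 1) * (v $ 2 * h $ 2)" by (simp add: e)
  also have "\<dots> = (v $ 1 * h $ 2) * (v $ 2 * h $ 1)" by (simp add: algebra_simps)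
  also have "\<dots> = 0" by (simp add: e)
  finally have "v $ i * h $ j = 0" for i j using e[of i j] by auto
  then show False using assms by (metis mult_eq_0_iff vec_eq_iff zero_index)
qed

lemma traceless_part_tensor_nonzero:
  assumes "v \<noteq> 0" "h \<noteq> (0 :: complex ^ 3)" shows "traceless_part (tensor v h) \<noteq> 0"
  using tensor_neq_scalar[OF assms] by (simp add: traceless_part_def)

definition frame_bivector where
  "frame_bivector i l c z = wedge2 (traceless_part z) (traceless_part (frame i l c z))"

lemma plane_of_basis:
  assumes nz: "v \<noteq> 0" "h \<noteq> 0"
  obtains i l c1 c2 c3 where
    "fam_indep (triple (frame_bivector i l c1 (tensor v h)) (frame_bivector i l c2 (tensor v h)) (frame_bivector i l c3 (tensor v h)))"
    "plane_of (tensor v h) =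
      span_fam (triple (frame_bivector i l c1 (tensor v h)) (frame_bivector i l c2 (tensor v h)) (frame_bivector i l c3 (tensor v h)))"
proof -
  define z where "z = tensor v h"
  from nz obtain l i where li: "v $ l \<noteq> 0" "h $ i \<noteq> 0" by (metis vec_eq_iff zero_index)
  then have zli: "z $ (l, i) \<noteq> 0" by (simp add: z_def)
  define x where "x = z - endo_trace z *s unit_endo"
  have xA: "x \<in> annihilator z"
    by (simp add: x_def annihilator_def endo_mul_simps z_def tensor_square)
  have tlx: "traceless_part x = traceless_part z" by (simp add: x_def traceless_part_simps)
  have "x \<noteq> 0" using tensor_neq_scalar[OF nz, of "endo_trace z"] by (simp add: x_def z_def)
  then have "frame i l x z \<noteq> 0" using frame_annihilator[OF xA] zli by simp
  then have "\<exists>r\<in>UNIV - {i}. \<exists>s\<in>UNIV - {l}. x $ (r, s) \<noteq> 0"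
    using frame_expand[of i l x z] by (metis (no_types, lifting) sum.neutral vec.scale_zero_left)
  then obtain j m where jm: "j \<noteq> i" "m \<noteq> l" "x $ (j, m) \<noteq> 0" by auto
  obtain k where k: "k \<noteq> i" "k \<noteq> j" "UNIV = {i, j, k}" by (rule UNIV_three_distinct[of i j]) (use jm in auto)
  obtain n where n: "n \<noteq> l" "n \<noteq> m" "UNIV = {l, m, n}" by (rule UNIV_three_distinct[of l m]) (use jm in auto)
  define b where "b r s = frame i l (axis (r, s) 1) z" for r s
  have bA: "b r s \<in> annihilator z" for r s unfolding b_def z_def by (rule frame_in_annihilator)
  define w where "w a = wedge2 (traceless_part z) (traceless_part a)" for a
  have wl: "w (a + a') = w a + w a'" "w (c *s a) = c *s w a" "w (a - a') = w a - w a'" for a a' c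
    by (simp_all add: w_def traceless_part_simps wedge2_simps)
  have wx: "w x = 0" by (simp add: w_def tlx wedge2_simps)
  have fb: "frame_bivector i l (axis (r, s) 1) z = w (b r s)" for r s
    by (simp add: frame_bivector_def w_def b_def)
  have exp: "z $ (l, i) *s a = a $ (j, m) *s b j m + a $ (j, n) *s b j n + a $ (k, m) *s b k m + a $ (k, n) *s b k n"
    if "a \<in> annihilator z" for a
    using frame_annihilator[OF that, of i l] frame_expand[of i l a z] k n jm
    by (simp add: UNIV_diff_three[OF k(3)] UNIV_diff_three[OF n(3)] b_def add.assoc)
  have fi: "fam_indep (triple (w (b j n)) (w (b k m)) (w (b k n)))"
    unfolding fam_indep_triple
  proof (intro allI impI)
    fix p q r assume s: "p *s w (b j n) + q *s w (b k m) + r *s w (b k n) = 0"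
    define a where "a = p *s b j n + q *s b k m + r *s b k n"
    have aA: "a \<in> annihilator z" unfolding a_def by (intro annihilator_simps bA)
    \<comment> \<open>This makes \<open>a - c x\<close> a scalar matrix for some \<open>c\<close>,
      and the only scalar matrix in the annihilator is 0.\<close>
    have "wedge2 (traceless_part z) (traceless_part a) = 0" using s by (simp add: a_def wl flip: w_def)
    then obtain c where c: "traceless_part a = c *s traceless_part z"
      using wedge2_zeroD traceless_part_tensor_nonzero[OF nz] unfolding z_def by metis
    then have "traceless_part (a - c *s x) = 0" by (simp add: traceless_part_simps tlx)
    then obtain t where t: "a - c *s x = t *s unit_endo" unfolding traceless_part_def by auto
    have "t *s unit_endo \<in> annihilator z" using aA xA unfolding t[symmetric] by (intro annihilator_simps)
    then have "t *s z = 0" by (simp add: annihilator_def endo_mul_simps)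
    then have "t = 0" using zli by auto
    then have ax: "a = c *s x" using t by simp
    \<comment> \<open>Off row \<open>i\<close> and column \<open>l\<close>, the only nonzero entry
      of \<open>b r s\<close> is \<open>z $ (l, i)\<close> at \<open>(r, s)\<close>.\<close>
    have ent: "a $ (j, m) = 0" "a $ (j, n) = p * z $ (l, i)" "a $ (k, m) = q * z $ (l, i)" "a $ (k, n) = r * z $ (l, i)"
      using jm k n by (simp_all add: a_def b_def frame_axis)
    have "c = 0" using ent(1) jm(3) ax by simp
    then have "a = 0" using ax by simp
    then show "p = 0 \<and> q = 0 \<and> r = 0" using ent zli by simp
  qed
  have "plane_of z = span_fam (triple (w (b j n)) (w (b k m)) (w (b k n)))"
  proof
    show "span_fam (triple (w (b j n)) (w (b k m)) (w (b k n))) \<subseteq> plane_of z"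
      using bA plane_of_tensor[OF nz] unfolding range_triple
      by (intro vec.span_minimal subspace_plane_of) (auto simp: w_def z_def)
    show "plane_of z \<subseteq> span_fam (triple (w (b j n)) (w (b k m)) (w (b k n)))"
    proof
      fix u assume "u \<in> plane_of z"
      then obtain a where u: "u = w a" and a: "a \<in> annihilator z"
        using plane_of_tensor[OF nz] by (auto simp: w_def z_def)
      \<comment> \<open>Subtracting a multiple of \<open>x\<close> preserves \<open>w a\<close> and
        clears the entry at the dropped position.\<close>
      define a' where "a' = a - (a $ (j, m) / x $ (j, m)) *s x"
      have a'A: "a' \<in> annihilator z" unfolding a'_def by (intro annihilator_simps a xA)
      have "a' $ (j, m) = 0" using jm by (simp add: a'_def)
      then have "z $ (l, i) *s w a' = a' $ (j, n) *s w (b j n) + a' $ (k, m) *s w (b k m) + a' $ (k, n) *s w (b k n)"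
        using arg_cong[OF exp[OF a'A], of w] by (simp add: wl)
      moreover have "w a' = u" by (simp add: a'_def wl wx u)
      moreover have "w (b j n) \<in> span_fam (triple (w (b j n)) (w (b k m)) (w (b k n)))"
        "w (b k m) \<in> span_fam (triple (w (b j n)) (w (b k m)) (w (b k n)))"
        "w (b k n) \<in> span_fam (triple (w (b j n)) (w (b k m)) (w (b k n)))"
        unfolding range_triple by (simp_all add: vec.span_base)
      ultimately have "z $ (l, i) *s u \<in> span_fam (triple (w (b j n)) (w (b k m)) (w (b k n)))"
        by (simp add: vec.span_add vec.span_scale)
      then have "(1 / z $ (l, i)) *s (z $ (l, i) *s u) \<in> span_fam (triple (w (b j n)) (w (b k m)) (w (b k n)))"
        by (rule vec.span_scale)
      then show "u \<in> span_fam (triple (w (b j n)) (w (b k m)) (w (b k n)))"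
        using zli by (simp add: vector_smult_assoc)
    qed
  qed
  then show thesis using that[of i l "axis (j, n) 1" "axis (k, m) 1" "axis (k, n) 1"] fi
    unfolding fb z_def[symmetric] by blast
qed

lemma plane_of_in_planes:
  assumes nz: "v \<noteq> 0" "h \<noteq> 0" shows "plane_of (tensor v h) \<in> planes_in_Y"
proof -
  obtain b :: "complex ^ ((3 \<times> 3) ^ 2) ^ 3" where "fam_indep b" "plane_of (tensor v h) = span_fam b"
    using plane_of_basis[OF nz] by metis
  then have "vec.dim (plane_of (tensor v h)) = 3" using dim_span_fam by fastforce
  then show ?thesis
    unfolding planes_in_Y_iff using subspace_plane_of abelian_bivector_plane_of by blast
qed

text \<open>A plane consists of the products of one \<open>x\<close> with the span of
  \<open>y1, y2, y3\<close>. As \<open>unit_endo, y1, y2, y3\<close> are independent and commute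
  with \<open>x\<close>, there is no cyclic vector, and \<open>x\<close> is the traceless part of
  some \<open>tensor v h\<close>. The plane then lies in \<open>plane_of (tensor v h)\<close>, of
  the same dimension.\<close>

lemma planes_in_Y_eq: "planes_in_Y = {plane_of (tensor v h) | v h. v \<noteq> 0 \<and> h \<noteq> 0}"
proof (intro equalityI subsetI)
  fix E assume "E \<in> planes_in_Y"
  then have E: "vec.subspace E" "vec.dim E = CARD(3)" "\<And>w. w\<in>E \<Longrightarrow> abelian_bivector w"
    by (simp_all add: planes_in_Y_iff)
  obtain b :: "complex ^ ((3 \<times> 3) ^ 2) ^ 3" where b: "fam_indep b" "E = span_fam b"
    by (rule subspace_eq_span_fam[OF E(1,2)])
  have fi: "fam_indep (triple (b $ 1) (b $ 2) (b $ 3))" using b(1) by (simp add: triple_eta)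
  have bE: "b $ k \<in> E" for k using b(2) by (auto intro: vec.span_base)
  have "p *s b $ 1 + q *s b $ 2 + r *s b $ 3 \<in> E" for p q r
    using E(1) bE by (intro vec.subspace_add vec.subspace_scale)
  then obtain x y1 y2 y3 where x: "b $ 1 = wedge2 x y1" "b $ 2 = wedge2 x y2" "b $ 3 = wedge2 x y3"
    using pencil_of_bivectors[OF fi] E(3) by metis
  have ind: "p *s b $ 1 + q *s b $ 2 + r *s b $ 3 = 0 \<Longrightarrow> p = 0 \<and> q = 0 \<and> r = 0" for p q r
    using fi unfolding fam_indep_triple by blast
  have nz: "b $ 1 \<noteq> 0" "b $ 2 \<noteq> 0" "b $ 3 \<noteq> 0" using ind[of 1 0 0] ind[of 0 1 0] ind[of 0 0 1] by auto
  have ab: "abelian_bivector (wedge2 x y1)" "abelian_bivector (wedge2 x y2)" "abelian_bivector (wedge2 x y3)"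
    using E(3) bE unfolding x[symmetric] by blast+
  note props = abelian_bivector_wedge2[OF ab(1) nz(1)[unfolded x]] abelian_bivector_wedge2[OF ab(2) nz(2)[unfolded x]]
    abelian_bivector_wedge2[OF ab(3) nz(3)[unfolded x]]
  have "fam_indep (triple y1 y2 y3)"
    unfolding fam_indep_triple
  proof (intro allI impI)
    fix p q r assume s: "p *s y1 + q *s y2 + r *s y3 = 0"
    have "p *s b $ 1 + q *s b $ 2 + r *s b $ 3 = 0"
      using arg_cong[OF s, of "wedge2 x"] by (simp add: wedge2_simps x)
    then show "p = 0 \<and> q = 0 \<and> r = 0" by (rule ind)
  qed
  then have f4: "fam_indep (quad unit_endo y1 y2 y3)" using fam_indep_triple_unit_endo props by blast
  have comm: "endo_mul (quad unit_endo y1 y2 y3 $ a) x = endo_mul x (quad unit_endo y1 y2 y3 $ a)" for a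
    using props exhaust_4[of a] by auto
  then have comm2: "endo_mul (quad unit_endo y1 y2 y3 $ a) (endo_mul x x) = endo_mul (endo_mul x x) (quad unit_endo y1 y2 y3 $ a)" for a
    by (metis endo_mul_assoc)
  have "det (triple u (endo_act x u) (endo_act x (endo_act x u))) = 0" for u
    using commuting_orbit_dependent[OF f4, of unit_endo x "endo_mul x x" u] comm comm2 by (simp add: endo_act_mul)
  then obtain s v h where svh: "x = s *s unit_endo + tensor v h" by (rule noncyclic_rank_one)
  then have x': "x = traceless_part (tensor v h)" using traceless_part_traceless[OF props(1)] by (simp add: traceless_part_simps)
  have vh: "v \<noteq> 0" "h \<noteq> 0"
  proof -
    have "x \<noteq> 0" using nz x by (auto simp: wedge2_simps)
    moreover have "tensor (0 :: complex ^ 3) h = 0" "tensor v (0 :: complex ^ 3) = 0" by (auto intro!: matrix_index_eqI)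
    ultimately show "v \<noteq> 0" "h \<noteq> 0" using x' by (auto simp: traceless_part_simps)
  qed
  have "wedge2 x y \<in> plane_of (tensor v h)" if "endo_trace y = 0" "endo_mul x y = endo_mul y x" for y
    using that endo_mul_traceless_part_commute unfolding plane_of_def x' by blast
  then have "b $ 1 \<in> plane_of (tensor v h)" "b $ 2 \<in> plane_of (tensor v h)" "b $ 3 \<in> plane_of (tensor v h)"
    using props unfolding x by blast+
  then have "range (($) b) \<subseteq> plane_of (tensor v h)"
    by (auto simp: UNIV_3)
  then have "E \<subseteq> plane_of (tensor v h)"
    unfolding b(2) by (intro vec.span_minimal subspace_plane_of)
  moreover have "vec.dim (plane_of (tensor v h)) = 3"
    using plane_of_in_planes[OF vh] by (simp add: planes_in_Y_iff)
  ultimately have "E = plane_of (tensor v h)"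
    using E by (intro vec.subspace_dim_equal subspace_plane_of) auto
  then show "E \<in> {plane_of (tensor v h) | v h. v \<noteq> 0 \<and> h \<noteq> 0}" using vh by blast
qed (use plane_of_in_planes in blast)

section \<open>Recovering a point from Pluecker coordinates\<close>

abbreviation coeff6 :: "complex ^ (('i :: finite ^ 2) ^ 3) \<Rightarrow> 'i \<Rightarrow> 'i \<Rightarrow> 'i \<Rightarrow> 'i \<Rightarrow> 'i \<Rightarrow> 'i \<Rightarrow> complex" where
  "coeff6 p a b c d e f \<equiv> p $ triple (pair a b) (pair c d) (pair e f)"

definition minor3 :: "complex ^ 'n \<Rightarrow> complex ^ 'n \<Rightarrow> complex ^ 'n \<Rightarrow> 'n \<Rightarrow> 'n \<Rightarrow> 'n \<Rightarrow> complex" where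
  "minor3 u v w a b c = u $ a * (v $ b * w $ c - v $ c * w $ b) - u $ b * (v $ a * w $ c - v $ c * w $ a)
     + u $ c * (v $ a * w $ b - v $ b * w $ a)"

lemma wedge3_component: "wedge3 u v w $ I = minor3 u v w (I $ 1) (I $ 2) (I $ 3)"
  by (simp add: wedge3_def wedge_def det_3 minor3_def algebra_simps)

text \<open>Each factor is \<open>x \<otimes> y - y \<otimes> x\<close>; the eight terms record
  which index of every pair falls on \<open>x\<close>.\<close>

lemma coeff6_pencil:
  "coeff6 (wedge3 (wedge2 x y1) (wedge2 x y2) (wedge2 x y3)) a b c d e f =
     x $ a * x $ c * x $ e * minor3 y1 y2 y3 b d f - x $ b * x $ c * x $ e * minor3 y1 y2 y3 a d f
   - x $ a * x $ d * x $ e * minor3 y1 y2 y3 b c f - x $ a * x $ c * x $ f * minor3 y1 y2 y3 b d e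
   + x $ b * x $ d * x $ e * minor3 y1 y2 y3 a c f + x $ b * x $ c * x $ f * minor3 y1 y2 y3 a d e
   + x $ a * x $ d * x $ f * minor3 y1 y2 y3 b c e - x $ b * x $ d * x $ f * minor3 y1 y2 y3 a c e"
  unfolding wedge3_component triple_nth minor3_def wedge2_nth by algebra

text \<open>Antisymmetrisation over \<open>k, l, m, n\<close>.  As \<open>p\<close> is already antisymmetric in its last two indices,
  twelve of the permutations suffice.\<close>

definition contract6 :: "complex ^ (('i :: finite ^ 2) ^ 3) \<Rightarrow> 'i \<Rightarrow> 'i \<Rightarrow> 'i \<Rightarrow> 'i \<Rightarrow> 'i \<Rightarrow> 'i \<Rightarrow> complex" where
  "contract6 p a r k l m n =
     coeff6 p a k r l m n - coeff6 p a l r k m n - coeff6 p a k r m l n + coeff6 p a m r k l n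
   + coeff6 p a k r n l m - coeff6 p a n r k l m + coeff6 p a l r m k n - coeff6 p a m r l k n
   - coeff6 p a l r n k m + coeff6 p a n r l k m + coeff6 p a m r n k l - coeff6 p a n r m k l"

text \<open>The bracket is the coordinate of \<open>x \<and> y1 \<and> y2 \<and> y3\<close> at
  \<open>k, l, m, n\<close>. The factor \<open>x $ a\<close> shows that, as a vector in
  \<open>a\<close>, each contraction is a multiple of \<open>x\<close>.\<close>

lemma contract6_pencil:
  fixes x y1 y2 y3 :: "complex ^ 'n"
  defines "p \<equiv> wedge3 (wedge2 x y1) (wedge2 x y2) (wedge2 x y3)"
  shows "contract6 p a r k l m n = x $ a * (6 * x $ r *
    (x $ k * minor3 y1 y2 y3 l m n - x $ l * minor3 y1 y2 y3 k m n + x $ m * minor3 y1 y2 y3 k l n - x $ n * minor3 y1 y2 y3 k l m))"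
  unfolding contract6_def p_def coeff6_pencil minor3_def by algebra


text \<open>Contraction loses no information on pencils: if all contractions vanish, so does the
  Pluecker vector. The relation is linear in \<open>p\<close> and serves later as an
  equation.\<close>

lemma pencil_from_contractions:
  fixes x y1 y2 y3 :: "complex ^ 'n"
  defines "p \<equiv> wedge3 (wedge2 x y1) (wedge2 x y2) (wedge2 x y3)"
  shows "6 * coeff6 p a b c d e f = contract6 p a c e b d f - contract6 p b c e a d f
    - contract6 p a d e b c f + contract6 p b d e a c f"
  unfolding contract6_pencil p_def coeff6_pencil minor3_def by algebra

definition contraction :: "(3 \<times> 3) \<Rightarrow> (3 \<times> 3) \<Rightarrow> (3 \<times> 3) \<Rightarrow> (3 \<times> 3) \<Rightarrow> (3 \<times> 3)
    \<Rightarrow> complex ^ (((3 \<times> 3) ^ 2) ^ 3) \<Rightarrow> complex ^ (3 \<times> 3)" where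
  "contraction r k l m n p = (\<chi> a. contract6 p a r k l m n)"

text \<open>If \<open>z\<close> has rank one, \<open>z\<^sup>2 = (tr z) z\<close> determines \<open>z\<close> from its traceless part.\<close>

definition recover :: "(3 \<times> 3) \<Rightarrow> complex ^ (3 \<times> 3) \<Rightarrow> complex ^ (3 \<times> 3)" where
  "recover s g = g $ s *s g + traceless_part (endo_mul g g) $ s *s unit_endo"

text \<open>Write \<open>x\<close> for the traceless part of \<open>z\<close> and
  \<open>\<tau>\<close> for its trace. Since \<open>z\<^sup>2 = \<tau> z\<close>, the traceless part
  of \<open>x\<^sup>2\<close> is \<open>(\<tau> / 3) x\<close>, and the two terms of
  \<open>recover\<close> add up to \<open>c\<^sup>2 x_s (x + (\<tau> / 3) I)\<close>.\<close>

lemma recover_traceless_part: "recover s (c *s traceless_part (tensor v h)) = (c ^ 2 * traceless_part (tensor v h) $ s) *s tensor v h"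
proof -
  define z where "z = tensor v h"
  have "endo_mul (traceless_part z) (traceless_part z) = (endo_trace z / 3) *s z + ((endo_trace z)^2 / 9) *s unit_endo"
    by (auto intro!: matrix_index_eqI simp: traceless_part_def endo_mul_simps z_def tensor_square power2_eq_square field_simps)
  then have "traceless_part (endo_mul (traceless_part z) (traceless_part z)) = (endo_trace z / 3) *s traceless_part z" by (simp add: traceless_part_simps)
  then have "traceless_part (endo_mul (c *s traceless_part z) (c *s traceless_part z)) = (c^2 * endo_trace z / 3) *s traceless_part z"
    by (simp add: endo_mul_simps traceless_part_simps vector_smult_assoc power2_eq_square)
  then have "traceless_part (endo_mul (c *s traceless_part z) (c *s traceless_part z)) $ s = c^2 * endo_trace z / 3 * traceless_part z $ s" by simp
  moreover have "z $ p = traceless_part z $ p + endo_trace z / 3 * unit_endo $ p" for p by (simp add: traceless_part_def)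
  ultimately show ?thesis
    unfolding recover_def z_def[symmetric] vec_eq_iff
    by (simp add: power2_eq_square algebra_simps)
qed

text \<open>For traceless \<open>g\<close> the trace of \<open>recover s g\<close> isolates the
  scalar term. If that vanishes, \<open>g $ s *s g\<close> remains, nonzero for a suitable
  \<open>s\<close>.\<close>

lemma recover_nonzero:
  assumes "g \<noteq> 0" "endo_trace g = 0" obtains s where "recover s g \<noteq> 0"
proof -
  obtain s where s: "g $ s \<noteq> 0" using assms(1) by (metis vec_eq_iff zero_index)
  have "recover s g \<noteq> 0"
  proof
    assume r: "recover s g = 0"
    have "traceless_part (endo_mul g g) $ s = 0"
      using arg_cong[OF r, of endo_trace] assms(2) by (simp add: recover_def endo_trace_simps)
    then show False using r s assms(1) by (simp add: recover_def)
  qed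
  then show thesis by (rule that)
qed

definition plane_coord :: "3 \<Rightarrow> 3 \<Rightarrow> complex ^ (3 \<times> 3) \<Rightarrow> complex ^ (3 \<times> 3) \<Rightarrow> complex ^ (3 \<times> 3) \<Rightarrow> complex ^ (3 \<times> 3)
    \<Rightarrow> complex ^ (((3 \<times> 3) ^ 2) ^ 3)" where
  "plane_coord i l c1 c2 c3 z = wedge3 (frame_bivector i l c1 z) (frame_bivector i l c2 z) (frame_bivector i l c3 z)"

lemma frame_bivector_in_plane_of:
  assumes "v \<noteq> 0" "h \<noteq> 0" shows "frame_bivector i l c (tensor v h) \<in> plane_of (tensor v h)"
  using plane_of_tensor[OF assms] frame_in_annihilator unfolding frame_bivector_def by blast

text \<open>Valid for all indices: away from its zeros, \<open>plane_coord\<close> represents the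
  plane, as a local formula for a regular map must.\<close>

lemma plane_coord_mem:
  assumes "v \<noteq> 0" "h \<noteq> 0"
  shows "plane_coord i l c1 c2 c3 (tensor v h) \<in> exterior_power (plane_of (tensor v h))"
  unfolding plane_coord_def wedge3_def exterior_power_def
proof (rule vec.span_base, rule CollectI, rule exI, rule conjI, rule refl, rule allI)
  fix a
  show "triple (frame_bivector i l c1 (tensor v h)) (frame_bivector i l c2 (tensor v h)) (frame_bivector i l c3 (tensor v h)) $ a
      \<in> plane_of (tensor v h)"
    using frame_bivector_in_plane_of[OF assms] exhaust_3[of a] by auto
qed

lemma plane_of_pluecker:
  assumes "v \<noteq> 0" "h \<noteq> 0"
  obtains i l c1 c2 c3 where "plane_coord i l c1 c2 c3 (tensor v h) \<noteq> 0"
    "exterior_power (plane_of (tensor v h)) = vec.span {plane_coord i l c1 c2 c3 (tensor v h)}"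
proof -
  let ?t = "\<lambda>i l c1 c2 c3. triple (frame_bivector i l c1 (tensor v h)) (frame_bivector i l c2 (tensor v h)) (frame_bivector i l c3 (tensor v h))"
  obtain i l c1 c2 c3 where *: "fam_indep (?t i l c1 c2 c3)" "plane_of (tensor v h) = span_fam (?t i l c1 c2 c3)"
    by (rule plane_of_basis[OF assms])
  have "plane_coord i l c1 c2 c3 (tensor v h) \<noteq> 0"
    unfolding plane_coord_def wedge3_def wedge_nonzero_iff by (rule *)
  moreover have "exterior_power (plane_of (tensor v h)) = vec.span {plane_coord i l c1 c2 c3 (tensor v h)}"
    unfolding *(2) exterior_power_span_fam plane_coord_def wedge3_def ..
  ultimately show thesis by (rule that)
qed

lemma coeff6_scale: "coeff6 (c *s p) a b d e f g = c * coeff6 p a b d e f g"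
  by simp

lemma contract6_scale: "contract6 (c *s p) a r k l m n = c * contract6 p a r k l m n"
  by (simp add: contract6_def algebra_simps)

lemma contraction_plane_of:
  assumes "v \<noteq> 0" "h \<noteq> 0" and p: "p \<in> exterior_power (plane_of (tensor v h))"
  shows "\<exists>c. contraction r k l m n p = c *s traceless_part (tensor v h)"
    and "6 * coeff6 p a b c d e f = contract6 p a c e b d f - contract6 p b c e a d f
    - contract6 p a d e b c f + contract6 p b d e a c f"
proof -
  obtain i j c1 c2 c3 where *: "exterior_power (plane_of (tensor v h)) = vec.span {plane_coord i j c1 c2 c3 (tensor v h)}"
    using plane_of_pluecker[OF assms(1,2)] by metis
  then obtain t where t: "p = t *s plane_coord i j c1 c2 c3 (tensor v h)" using p in_span_singleton by metis
  show "\<exists>c. contraction r k l m n p = c *s traceless_part (tensor v h)"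
  proof -
    have "\<exists>K. \<forall>a. contract6 (plane_coord i j c1 c2 c3 (tensor v h)) a r k l m n = traceless_part (tensor v h) $ a * K"
      unfolding plane_coord_def frame_bivector_def contract6_pencil by blast
    then obtain K where "\<And>a. contract6 (plane_coord i j c1 c2 c3 (tensor v h)) a r k l m n = traceless_part (tensor v h) $ a * K"
      by blast
    then show ?thesis
      by (intro exI[of _ "t * K"]) (simp add: vec_eq_iff contraction_def t contract6_scale)
  qed
  show "6 * coeff6 p a b c d e f = contract6 p a c e b d f - contract6 p b c e a d f
    - contract6 p a d e b c f + contract6 p b d e a c f"
    using arg_cong[OF pencil_from_contractions[of "traceless_part (tensor v h)" "traceless_part (frame i j c1 (tensor v h))"
        "traceless_part (frame i j c2 (tensor v h))" "traceless_part (frame i j c3 (tensor v h))" a b c d e f], of "\<lambda>x. t * x"]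
    unfolding t contract6_scale coeff6_scale plane_coord_def frame_bivector_def
    by (simp only: right_diff_distrib distrib_left mult.left_commute)
qed

section \<open>Degrees of the coordinate formulas\<close>

lemma hom_poly_endo_trace: "hom_poly 1 endo_trace"
  unfolding endo_trace_def by (intro hom_poly_sum hom_poly.coord)

lemma hom_poly_traceless_part: "hom_poly 1 (\<lambda>z. traceless_part z $ p)"
  unfolding traceless_part_def
  by (simp, intro hom_poly_diff hom_poly_multc hom_poly_divide hom_poly.coord[simplified] hom_poly_endo_trace[simplified])

lemma hom_poly_frame: "hom_poly 1 (\<lambda>z. frame i l c z $ p)"
  unfolding frame_def vec_lambda_beta
  by (intro hom_poly.add hom_poly_diff hom_poly_cmult hom_poly_multc hom_poly_if hom_poly_sum hom_poly.coord hom_poly_zero)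

lemma hom_poly_frame_bivector: "hom_poly 2 (\<lambda>z. frame_bivector i l c z $ J)"
proof -
  have "hom_poly (1 * 1) (\<lambda>z. traceless_part (frame i l c z) $ p)" for p
    by (rule hom_poly_compose[OF hom_poly_traceless_part hom_poly_frame])
  then have f: "hom_poly 1 (\<lambda>z. traceless_part (frame i l c z) $ p)" for p by simp
  show ?thesis
    unfolding frame_bivector_def wedge2_component
    by (intro hom_poly_diff hom_poly_mult_eq[OF hom_poly_traceless_part f]) simp_all
qed

lemma hom_poly_plane_coord: "hom_poly 6 (\<lambda>z. plane_coord i l c1 c2 c3 z $ I)"
proof -
  have 4: "hom_poly 4 (\<lambda>z. frame_bivector i l c z $ J * frame_bivector i l c' z $ J')" for c c' J J'
    by (rule hom_poly_mult_eq[OF hom_poly_frame_bivector hom_poly_frame_bivector]) simp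
  show ?thesis
    unfolding plane_coord_def wedge3_component minor3_def
    by (intro hom_poly.add hom_poly_diff hom_poly_mult_eq[OF hom_poly_frame_bivector hom_poly_diff[OF 4 4]]) simp_all
qed

lemma hom_poly_contract6: "hom_poly 1 (\<lambda>p. contract6 p a r k l m n)"
  unfolding contract6_def by (intro hom_poly.add hom_poly_diff hom_poly.coord)

lemma hom_poly_recover: "hom_poly 2 (\<lambda>g. recover s g $ p)"
proof -
  have "hom_poly 2 (\<lambda>g. endo_mul g g $ q)" for q
    unfolding endo_mul_def vec_lambda_beta
    by (intro hom_poly_sum hom_poly_mult_eq[OF hom_poly.coord hom_poly.coord]) simp
  then have "hom_poly (1 * 2) (\<lambda>g. traceless_part (endo_mul g g) $ s)"
    by (intro hom_poly_compose[OF hom_poly_traceless_part])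
  moreover have "hom_poly 2 (\<lambda>g. g $ s * g $ p)"
    by (rule hom_poly_mult_eq[OF hom_poly.coord hom_poly.coord]) simp
  ultimately show ?thesis
    unfolding recover_def by (simp add: hom_poly.add hom_poly_multc)
qed

definition recovered where
  "recovered r k l m n s p = recover s (contraction r k l m n p)"

lemma hom_poly_recovered: "hom_poly 2 (\<lambda>p. recovered r k l m n s p $ j)"
proof -
  have "hom_poly 1 (\<lambda>p. contraction r k l m n p $ a)" for a
    unfolding contraction_def vec_lambda_beta by (rule hom_poly_contract6)
  from hom_poly_compose[OF hom_poly_recover this] show ?thesis
    unfolding recovered_def by simp
qed

lemma recovered_plane_of:
  assumes "v \<noteq> 0" "h \<noteq> 0" "p \<in> exterior_power (plane_of (tensor v h))"
  shows "recovered r k l m n s p \<in> vec.span {tensor v h}"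
  using contraction_plane_of(1)[OF assms] recover_traceless_part in_span_singleton
  unfolding recovered_def by metis

text \<open>If all contractions vanished, \<open>eq\<close> would give \<open>p = 0\<close>; a
  nonzero one is traceless, so \<open>recover_nonzero\<close> applies. The hypotheses are equations
  in \<open>p\<close>, so the lemma applies before \<open>p\<close> is known to come from a
  plane.\<close>

lemma ex_recovered_nonzero:
  assumes p: "p \<noteq> 0" and tr: "\<And>r k l m n. endo_trace (contraction r k l m n p) = 0"
    and eq: "\<And>a b c d e f. 6 * coeff6 p a b c d e f = contract6 p a c e b d f - contract6 p b c e a d f
      - contract6 p a d e b c f + contract6 p b d e a c f"
  obtains r k l m n s where "recovered r k l m n s p \<noteq> 0"
proof -
  obtain I where "p $ I \<noteq> 0" using p by (metis vec_eq_iff zero_index)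
  moreover have "I = triple (pair (I$1$1) (I$1$2)) (pair (I$2$1) (I$2$2)) (pair (I$3$1) (I$3$2))"
    by (simp add: pair_eta triple_eta)
  ultimately have "6 * coeff6 p (I$1$1) (I$1$2) (I$2$1) (I$2$2) (I$3$1) (I$3$2) \<noteq> 0" by simp
  then have "\<exists>a r k l m n. contract6 p a r k l m n \<noteq> 0"
    unfolding eq by (metis diff_zero add_0)
  then obtain a r k l m n where "contract6 p a r k l m n \<noteq> 0" by blast
  then have "contraction r k l m n p $ a \<noteq> 0" by (simp add: contraction_def)
  then have "contraction r k l m n p \<noteq> 0" by (metis zero_index)
  then show thesis
    using recover_nonzero tr that unfolding recovered_def by metis
qed

section \<open>Equations and the isomorphism\<close>

text \<open>A property of vectors rather than of lines, so that systems of equations can be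
  assembled by conjunction and quantification.\<close>

definition homogeneous_condition :: "(complex ^ 'n \<Rightarrow> bool) \<Rightarrow> bool" where
  "homogeneous_condition P \<longleftrightarrow> (\<exists>F. (\<forall>f\<in>F. \<exists>d. hom_poly d f) \<and> (\<forall>x. P x \<longleftrightarrow> (\<forall>f\<in>F. f x = 0)))"

lemma homogeneous_condition_eq:
  assumes "hom_poly d f" "hom_poly d g" shows "homogeneous_condition (\<lambda>x. f x = g x)"
  unfolding homogeneous_condition_def
  using hom_poly_diff[OF assms] by (intro exI[of _ "{\<lambda>x. f x - g x}"]) auto

lemma homogeneous_condition_all:
  assumes "\<And>n. homogeneous_condition (P n)" shows "homogeneous_condition (\<lambda>x. \<forall>n. P n x)"
proof -
  obtain F where "\<And>n. (\<forall>f\<in>F n. \<exists>d. hom_poly d f) \<and> (\<forall>x. P n x \<longleftrightarrow> (\<forall>f\<in>F n. f x = 0))"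
    using assms unfolding homogeneous_condition_def by metis
  then show ?thesis
    unfolding homogeneous_condition_def by (intro exI[of _ "\<Union>n. F n"]) auto
qed

lemma homogeneous_condition_conj:
  assumes "homogeneous_condition P" "homogeneous_condition Q"
  shows "homogeneous_condition (\<lambda>x. P x \<and> Q x)"
proof -
  obtain F G where "\<forall>f\<in>F. \<exists>d. hom_poly d f" "\<And>x. P x \<longleftrightarrow> (\<forall>f\<in>F. f x = 0)"
    "\<forall>f\<in>G. \<exists>d. hom_poly d f" "\<And>x. Q x \<longleftrightarrow> (\<forall>f\<in>G. f x = 0)"
    using assms unfolding homogeneous_condition_def by blast
  then show ?thesis
    unfolding homogeneous_condition_def by (intro exI[of _ "F \<union> G"]) auto
qed

lemma zariski_closed_condition:
  assumes "homogeneous_condition P" shows "zariski_closed {L \<in> proj UNIV. \<forall>x\<in>L. P x}"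
proof -
  obtain F where F: "\<forall>f\<in>F. \<exists>d. hom_poly d f" "\<And>x. P x \<longleftrightarrow> (\<forall>f\<in>F. f x = 0)"
    using assms unfolding homogeneous_condition_def by blast
  show ?thesis
    unfolding zariski_closed_def by (rule exI[of _ F]) (use F in auto)
qed

section \<open>The Segre variety\<close>

definition segre_condition :: "complex ^ ('n :: finite \<times> 'm :: finite) \<Rightarrow> bool" where
  "segre_condition x \<longleftrightarrow> (\<forall>r s i j. x $ (r, s) * x $ (i, j) = x $ (r, j) * x $ (i, s))"

lemma segre_condition_tensor: "segre_condition (c *s tensor v h)"
  by (simp add: segre_condition_def tensor_def)

lemma segre_condition_imp_tensor:
  assumes "segre_condition x" "x \<noteq> 0" obtains v h where "x = tensor v h"
proof -
  obtain i j where "x $ (i, j) \<noteq> 0" using assms(2) by (metis matrix_index_eqI zero_index)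
  then show thesis using tensor_if_minors assms(1) that unfolding segre_condition_def by metis
qed

lemma homogeneous_segre_condition:
  assumes "\<And>j. hom_poly d (\<lambda>x. f x $ j)"
  shows "homogeneous_condition (\<lambda>x. segre_condition (f x))"
  unfolding segre_condition_def
  by (intro homogeneous_condition_all homogeneous_condition_eq[of "d + d"] hom_poly.mult assms)

lemma tensor_eq_0_iff: "tensor v h = 0 \<longleftrightarrow> v = 0 \<or> h = 0"
  for v :: "complex ^ 'n :: finite" and h :: "complex ^ 'm :: finite"
proof
  show "tensor v h = 0 \<Longrightarrow> v = 0 \<or> h = 0"
    unfolding vec_eq_iff tensor_def by auto
  show "v = 0 \<or> h = 0 \<Longrightarrow> tensor v h = 0" by (auto simp: vec_eq_iff tensor_def)
qed

lemma prod_variety_UNIV: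
  "prod_variety (proj UNIV) (proj UNIV) =
    {vec.span {tensor v h} | v h. v \<noteq> (0 :: complex ^ 'n :: finite) \<and> h \<noteq> (0 :: complex ^ 'm :: finite)}"
proof -
  have "segre (vec.span {v}, vec.span {h}) = vec.span {tensor v h}" for v :: "complex ^ 'n" and h :: "complex ^ 'm"
  proof -
    have "tensor (a *s v) (b *s h) = (a * b) *s tensor v h" for a b
      by (simp add: vec_eq_iff tensor_def)
    then have "{tensor v' h' | v' h'. v' \<in> vec.span {v} \<and> h' \<in> vec.span {h}} \<subseteq> vec.span {tensor v h}"
      by (auto simp: in_span_singleton)
    moreover have "tensor v h \<in> {tensor v' h' | v' h'. v' \<in> vec.span {v} \<and> h' \<in> vec.span {h}}"
      by (intro CollectI exI[of _ v] exI[of _ h]) (simp add: vec.span_base)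
    ultimately show ?thesis
      unfolding segre_def prod.case by (intro vec.span_eq[THEN iffD2]) (auto intro: vec.span_base)
  qed
  note seg = this
  show ?thesis (is "?A = ?B")
  proof (intro equalityI subsetI)
    fix L assume "L \<in> ?A"
    then obtain M N where L: "L = segre (M, N)" "M \<in> proj UNIV" "N \<in> proj UNIV"
      unfolding prod_variety_def by blast
    then obtain v h where "v \<noteq> 0" "h \<noteq> 0" "M = vec.span {v}" "N = vec.span {h}"
      unfolding proj_UNIV_iff by blast
    then show "L \<in> ?B" using L(1) seg by blast
  next
    fix L assume "L \<in> ?B"
    then obtain v h where vh: "v \<noteq> 0" "h \<noteq> 0" "L = segre (vec.span {v}, vec.span {h})"
      using seg by blast
    then have "(vec.span {v}, vec.span {h}) \<in> proj UNIV \<times> proj UNIV"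
      by (auto simp: proj_UNIV_iff)
    then show "L \<in> ?A" unfolding prod_variety_def vh(3) by (rule imageI)
  qed
qed

text \<open>The 2x2 minors cut out the decomposable tensors.\<close>

lemma zariski_closed_segre:
  "zariski_closed (prod_variety (proj UNIV) (proj UNIV) :: (complex ^ ('n :: finite \<times> 'm :: finite)) set set)"
proof -
  have "{L \<in> proj UNIV. \<forall>x\<in>L. segre_condition x} =
    (prod_variety (proj UNIV) (proj UNIV) :: (complex ^ ('n \<times> 'm)) set set)" (is "?A = ?B")
  proof (intro equalityI subsetI)
    fix L assume L: "L \<in> ?A"
    then obtain x where x: "x \<noteq> 0" "L = vec.span {x}" by (auto simp: proj_UNIV_iff)
    then have "segre_condition x" using L by (simp add: vec.span_base)
    then obtain v h where "x = tensor v h" using segre_condition_imp_tensor x(1) by blast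
    then show "L \<in> ?B" using x unfolding prod_variety_UNIV by (auto simp: tensor_eq_0_iff)
  next
    fix L assume "L \<in> ?B"
    then obtain v h where vh: "v \<noteq> 0" "h \<noteq> 0" "L = vec.span {tensor v h}" unfolding prod_variety_UNIV by blast
    then have "tensor v h \<noteq> 0" by (simp add: tensor_eq_0_iff)
    then have "L \<in> proj UNIV" using vh proj_UNIV_iff by blast
    then show "L \<in> ?A" using vh by (auto simp: in_span_singleton segre_condition_tensor)
  qed
  moreover have "homogeneous_condition (segre_condition :: complex ^ ('n \<times> 'm) \<Rightarrow> bool)"
    using homogeneous_segre_condition[OF hom_poly.coord] .
  note zariski_closed_condition[OF this]
  ultimately show ?thesis by simp
qed

section \<open>Equations for the variety of planes\<close>

lemma plane_of_scale:
  assumes "c \<noteq> 0" shows "plane_of (c *s z) = plane_of z"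
proof -
  have "plane_of (a *s z) \<subseteq> plane_of z" if "a \<noteq> 0" for a z
  proof
    fix w assume "w \<in> plane_of (a *s z)"
    then obtain y where "w = wedge2 (traceless_part (a *s z)) y" "endo_trace y = 0" "endo_mul (a *s z) y = endo_mul y (a *s z)"
      unfolding plane_of_def by blast
    then show "w \<in> plane_of z"
      using that unfolding plane_of_def
      by (intro CollectI exI[of _ "a *s y"]) (simp add: traceless_part_simps wedge2_simps endo_trace_simps endo_mul_simps)
  qed
  \<comment> \<open>The second instance scales back by \<open>1 / c\<close> and gives the reverse
    inclusion.\<close>
  from this[OF assms, of z] this[of "1 / c" "c *s z"] show ?thesis
    using assms by (simp add: vector_smult_assoc)
qed

lemma exterior_plane_of_eq_span:
  fixes p :: "complex ^ (((3 \<times> 3) ^ 2) ^ 3)"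
  assumes "v \<noteq> 0" "h \<noteq> 0" "p \<in> exterior_power (plane_of (tensor v h))" "p \<noteq> 0"
  shows "exterior_power (plane_of (tensor v h)) = vec.span {p}"
proof -
  obtain q :: "complex ^ (((3 \<times> 3) ^ 2) ^ 3)" where "exterior_power (plane_of (tensor v h)) = vec.span {q}"
    using plane_of_pluecker[OF assms(1,2)] by blast
  then show ?thesis using assms(3,4) span_singleton_eq by metis
qed

lemma variety_of_planes_eq:
  "variety_of_planes_in_Y = {exterior_power (plane_of (tensor v h)) | v h. v \<noteq> 0 \<and> h \<noteq> 0}"
  unfolding variety_of_planes_in_Y_def pluecker_def planes_in_Y_eq by blast

lemma ex_recovered_plane_of:
  assumes "v \<noteq> 0" "h \<noteq> 0" "p \<in> exterior_power (plane_of (tensor v h))" "p \<noteq> 0"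
  obtains r k l m n s where "recovered r k l m n s p \<noteq> 0"
proof (rule ex_recovered_nonzero[OF assms(4)])
  show "endo_trace (contraction r k l m n p) = 0" for r k l m n
    using contraction_plane_of(1)[OF assms(1-3)] traceless_part_simps(4) endo_trace_simps(3) by (metis mult_zero_right)
qed (use contraction_plane_of(2)[OF assms(1-3)] that in blast)+

lemma plane_coord_mem_span:
  assumes "v \<noteq> 0" "h \<noteq> 0" "z \<in> vec.span {tensor v h}"
  shows "plane_coord i l c1 c2 c3 z \<in> exterior_power (plane_of (tensor v h))"
proof -
  obtain c where "z = c *s tensor v h" using assms(3) in_span_singleton by blast
  then have "plane_coord i l c1 c2 c3 z = c ^ 6 *s plane_coord i l c1 c2 c3 (tensor v h)"
    using hom_poly_vec_scale[OF hom_poly_plane_coord] by simp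
  then show ?thesis
    using plane_coord_mem[OF assms(1,2)] unfolding exterior_power_def by (simp add: vec.span_scale)
qed

text \<open>The first two families of equations guarantee that some \<open>recovered\<close> vector of \<open>p \<noteq> 0\<close> is nonzero;
  the other two say that it has rank one and that \<open>p\<close> represents the corresponding plane.\<close>

definition plane_condition :: "complex ^ (((3 \<times> 3) ^ 2) ^ 3) \<Rightarrow> bool" where
  "plane_condition p \<longleftrightarrow>
    (\<forall>a b c d e f. 6 * coeff6 p a b c d e f = contract6 p a c e b d f - contract6 p b c e a d f
      - contract6 p a d e b c f + contract6 p b d e a c f) \<and>
    (\<forall>r k l m n. endo_trace (contraction r k l m n p) = 0) \<and>
    (\<forall>r k l m n s. segre_condition (recovered r k l m n s p)) \<and>
    (\<forall>r k l m n s i j c1 c2 c3 I J. plane_coord i j c1 c2 c3 (recovered r k l m n s p) $ I * p $ J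
      = plane_coord i j c1 c2 c3 (recovered r k l m n s p) $ J * p $ I)"

lemma homogeneous_plane_condition: "homogeneous_condition plane_condition"
proof -
  have 1: "homogeneous_condition (\<lambda>p. 6 * coeff6 p a b c d e f = contract6 p a c e b d f - contract6 p b c e a d f
      - contract6 p a d e b c f + contract6 p b d e a c f)" for a b c d e f :: "3 \<times> 3"
    by (intro homogeneous_condition_eq[of 1] hom_poly.add hom_poly_diff hom_poly_cmult hom_poly_contract6 hom_poly.coord)
  have c: "hom_poly 1 (\<lambda>p. contraction r k l m n p $ a)" for r k l m n a
    unfolding contraction_def vec_lambda_beta by (rule hom_poly_contract6)
  have "hom_poly 1 (\<lambda>p. endo_trace (contraction r k l m n p))" for r k l m n
    unfolding endo_trace_def by (intro hom_poly_sum c)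
  then have 2: "homogeneous_condition (\<lambda>p. endo_trace (contraction r k l m n p) = 0)" for r k l m n
    using homogeneous_condition_eq hom_poly_zero by blast
  have 3: "homogeneous_condition (\<lambda>p. segre_condition (recovered r k l m n s p))" for r k l m n s
    by (rule homogeneous_segre_condition[OF hom_poly_recovered])
  have "hom_poly (6 * 2) (\<lambda>p. plane_coord i j c1 c2 c3 (recovered r k l m n s p) $ I)" for r k l m n s i j c1 c2 c3 I
    by (rule hom_poly_compose[OF hom_poly_plane_coord hom_poly_recovered])
  then have 4: "homogeneous_condition (\<lambda>p. plane_coord i j c1 c2 c3 (recovered r k l m n s p) $ I * p $ J
      = plane_coord i j c1 c2 c3 (recovered r k l m n s p) $ J * p $ I)" for r k l m n s i j c1 c2 c3 I J
    by (intro homogeneous_condition_eq[of "6 * 2 + 1"] hom_poly.mult hom_poly.coord)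
  show ?thesis
    unfolding plane_condition_def
    by (intro homogeneous_condition_conj homogeneous_condition_all 1 2 3 4)
qed

lemma plane_condition_plane_of:
  assumes nz: "v \<noteq> 0" "h \<noteq> 0" and p: "p \<in> exterior_power (plane_of (tensor v h))"
  shows "plane_condition p"
  unfolding plane_condition_def
proof (intro conjI allI)
  fix a b c d e f
  show "6 * coeff6 p a b c d e f = contract6 p a c e b d f - contract6 p b c e a d f
      - contract6 p a d e b c f + contract6 p b d e a c f"
    by (rule contraction_plane_of(2)[OF assms])
next
  fix r k l m n
  obtain c where "contraction r k l m n p = c *s traceless_part (tensor v h)" using contraction_plane_of(1)[OF assms] by blast
  then show "endo_trace (contraction r k l m n p) = 0" by (simp add: endo_trace_simps traceless_part_simps)
next
  fix r k l m n s
  show "segre_condition (recovered r k l m n s p)"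
    using recovered_plane_of[OF assms] segre_condition_tensor in_span_singleton by metis
next
  fix r k l m n s i j c1 c2 c3 I J
  let ?q = "plane_coord i j c1 c2 c3 (recovered r k l m n s p)"
  obtain p0 :: "complex ^ (((3 \<times> 3) ^ 2) ^ 3)" where p0: "exterior_power (plane_of (tensor v h)) = vec.span {p0}"
    using plane_of_pluecker[OF nz] by blast
  \<comment> \<open>Both \<open>?q\<close> and \<open>p\<close> lie on the Pluecker line of the
    plane, hence are proportional.\<close>
  have "?q \<in> vec.span {p0}"
    unfolding p0[symmetric] by (rule plane_coord_mem_span[OF nz recovered_plane_of[OF assms]])
  then obtain a b where ab: "?q = a *s p0" "p = b *s p0" using p p0 in_span_singleton by blast
  show "?q $ I * p $ J = ?q $ J * p $ I"
    unfolding ab(1) by (simp add: ab(2))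
qed

text \<open>Some \<open>recovered\<close> vector is nonzero and of the form
  \<open>tensor v h\<close>. For a \<open>plane_coord\<close> that does not vanish there, the last
  family of equations makes \<open>p\<close> proportional to the Pluecker vector of the
  plane.\<close>

lemma plane_condition_imp_plane_of:
  assumes c: "plane_condition p" and p: "p \<noteq> 0"
  obtains v h where "v \<noteq> 0" "h \<noteq> 0" "vec.span {p} = exterior_power (plane_of (tensor v h))"
proof -
  note pc = c[unfolded plane_condition_def]
  have c1: "6 * coeff6 p a b c d e f = contract6 p a c e b d f - contract6 p b c e a d f
      - contract6 p a d e b c f + contract6 p b d e a c f" for a b c d e f
    by (rule pc[THEN conjunct1, rule_format])
  have c2: "endo_trace (contraction r k l m n p) = 0" for r k l m n
    by (rule pc[THEN conjunct2, THEN conjunct1, rule_format])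
  obtain r k l m n s where nz: "recovered r k l m n s p \<noteq> 0"
    by (rule ex_recovered_nonzero[OF p c2 c1])
  have "segre_condition (recovered r k l m n s p)"
    by (rule pc[THEN conjunct2, THEN conjunct2, THEN conjunct1, rule_format])
  then obtain v h where vh: "recovered r k l m n s p = tensor v h" using nz by (rule segre_condition_imp_tensor)
  then have vh0: "v \<noteq> 0" "h \<noteq> 0" using nz by (auto simp: tensor_eq_0_iff)
  obtain i j c1 c2 c3 where q: "plane_coord i j c1 c2 c3 (tensor v h) \<noteq> 0"
    "exterior_power (plane_of (tensor v h)) = vec.span {plane_coord i j c1 c2 c3 (tensor v h)}"
    by (rule plane_of_pluecker[OF vh0])
  define q where "q = plane_coord i j c1 c2 c3 (tensor v h)"
  have par: "q $ I * p $ J = q $ J * p $ I" for I J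
    unfolding q_def vh[symmetric] by (rule pc[THEN conjunct2, THEN conjunct2, THEN conjunct2, rule_format])
  obtain I where I: "q $ I \<noteq> 0" using q(1) unfolding q_def by (metis vec_eq_iff zero_index)
  have "p = (p $ I / q $ I) *s q"
    using par[of I] I by (simp add: vec_eq_iff field_simps)
  then have "p \<in> vec.span {q}" using in_span_singleton by blast
  then have "vec.span {p} = exterior_power (plane_of (tensor v h))"
    unfolding q(2) q_def[symmetric] using p by (rule span_singleton_eq)
  then show thesis using that vh0 by blast
qed

lemma variety_of_planes_subset_proj: "variety_of_planes_in_Y \<subseteq> proj UNIV"
  proof
  fix L assume "L \<in> variety_of_planes_in_Y"
  then obtain v h where vh: "v \<noteq> 0" "h \<noteq> 0" "L = exterior_power (plane_of (tensor v h))"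
    unfolding variety_of_planes_eq by blast
  obtain p where "p \<noteq> 0" "L = vec.span {p}" using plane_of_pluecker[OF vh(1,2)] vh(3) by blast
  then show "L \<in> proj UNIV" unfolding proj_UNIV_iff by blast
qed

lemma zariski_closed_variety_of_planes: "zariski_closed variety_of_planes_in_Y"
proof -
  have "{L \<in> proj UNIV. \<forall>p\<in>L. plane_condition p} = variety_of_planes_in_Y"
  proof (intro equalityI subsetI)
    fix L assume L: "L \<in> {L \<in> proj UNIV. \<forall>p\<in>L. plane_condition p}"
    then obtain p where p: "p \<noteq> 0" "L = vec.span {p}" using proj_UNIV_iff by blast
    then have "plane_condition p" using L by (simp add: vec.span_base)
    then show "L \<in> variety_of_planes_in_Y"
      using plane_condition_imp_plane_of[OF _ p(1)] p(2) unfolding variety_of_planes_eq by blast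
  next
    fix L assume L: "L \<in> variety_of_planes_in_Y"
    then show "L \<in> {L \<in> proj UNIV. \<forall>p\<in>L. plane_condition p}"
      using variety_of_planes_subset_proj plane_condition_plane_of unfolding variety_of_planes_eq by blast
  qed
  then show ?thesis using zariski_closed_condition[OF homogeneous_plane_condition] by simp
qed

section \<open>The isomorphism\<close>

definition plane_map :: "(complex ^ (3 \<times> 3)) set \<Rightarrow> (complex ^ (((3 \<times> 3) ^ 2) ^ 3)) set" where
  "plane_map M = exterior_power (plane_of (SOME z. z \<in> M \<and> z \<noteq> 0))"

text \<open>By \<open>plane_of_scale\<close> the value does not depend on the vector picked by
  \<open>SOME\<close>.\<close>

lemma plane_map_span:
  assumes "v \<noteq> 0" "h \<noteq> 0"
  shows "plane_map (vec.span {tensor v h}) = exterior_power (plane_of (tensor v h))"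
proof -
  have "tensor v h \<in> vec.span {tensor v h} \<and> tensor v h \<noteq> 0"
    using assms by (simp add: tensor_eq_0_iff vec.span_base)
  then obtain z where z: "z = (SOME z. z \<in> vec.span {tensor v h} \<and> z \<noteq> 0)" "z \<in> vec.span {tensor v h}" "z \<noteq> 0"
    using someI[of "\<lambda>z. z \<in> vec.span {tensor v h} \<and> z \<noteq> 0"] by blast
  then obtain c where c: "z = c *s tensor v h" using in_span_singleton by blast
  then have "c \<noteq> 0" using z(3) by auto
  then have "plane_of z = plane_of (tensor v h)" unfolding c by (rule plane_of_scale)
  then show ?thesis unfolding plane_map_def z(1)[symmetric] by simp
qed

theorem proposition3p1:
  "isomorphic_varieties variety_of_planes_in_Y (prod_variety (proj W) (proj W_dual))"
proof -
  define S :: "(complex ^ (3 \<times> 3)) set set" where "S = prod_variety (proj W) (proj W_dual)"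
  have S: "S = {vec.span {tensor v h} | v h. v \<noteq> 0 \<and> h \<noteq> 0}"
    unfolding S_def W_def W_dual_def by (rule prod_variety_UNIV)
  have Sproj: "S \<subseteq> proj UNIV"
    unfolding S proj_UNIV_iff subset_iff using tensor_eq_0_iff by blast
  have im: "plane_map ` S = variety_of_planes_in_Y"
  proof (intro equalityI subsetI)
    fix L assume "L \<in> plane_map ` S"
    then show "L \<in> variety_of_planes_in_Y" using plane_map_span unfolding S variety_of_planes_eq by blast
  next
    fix L assume "L \<in> variety_of_planes_in_Y"
    then obtain v h where "v \<noteq> 0" "h \<noteq> 0" "L = plane_map (vec.span {tensor v h})"
      using plane_map_span unfolding variety_of_planes_eq by blast
    then show "L \<in> plane_map ` S" unfolding S by blast
  qed
  \<comment> \<open>Wherever a \<open>recovered\<close> vector is nonzero, it spans the original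
    point, whichever indices are used.\<close>
  have inv: "M = vec.span {recovered r k l m n s p}"
    if M: "M \<in> S" and p: "p \<in> plane_map M" "recovered r k l m n s p \<noteq> 0" for M p r k l m n s
  proof -
    obtain v h where vh: "v \<noteq> 0" "h \<noteq> 0" "M = vec.span {tensor v h}" using M S by blast
    have "recovered r k l m n s p \<in> vec.span {tensor v h}"
      by (rule recovered_plane_of[OF vh(1,2)]) (use p(1) vh plane_map_span in simp)
    then show ?thesis using span_singleton_eq p(2) vh(3) by blast
  qed
  have ex: "\<exists>p r k l m n s. p \<in> L \<and> recovered r k l m n s p \<noteq> 0" if L: "L \<in> variety_of_planes_in_Y" for L
  proof -
    obtain v h where vh: "v \<noteq> 0" "h \<noteq> 0" "L = exterior_power (plane_of (tensor v h))"
      using L variety_of_planes_eq by blast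
    have "L \<in> proj UNIV" using L variety_of_planes_subset_proj by blast
    then obtain p where p: "p \<noteq> 0" "L = vec.span {p}" unfolding proj_UNIV_iff by blast
    then have "p \<in> L" by (simp add: vec.span_base)
    then obtain r k l m n s where "recovered r k l m n s p \<noteq> 0"
      using ex_recovered_plane_of[OF vh(1,2) _ p(1)] vh(3) by blast
    then show ?thesis using \<open>p \<in> L\<close> by blast
  qed
  \<comment> \<open>Two points with the same image are spanned by the same nonzero
    \<open>recovered\<close> vector.\<close>
  have inj: "inj_on plane_map S"
  proof (rule inj_onI)
    fix M N assume M: "M \<in> S" "N \<in> S" "plane_map M = plane_map N"
    then have "plane_map M \<in> variety_of_planes_in_Y" using im by blast
    then obtain p r k l m n s where p: "p \<in> plane_map M" "recovered r k l m n s p \<noteq> 0" using ex by blast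
    show "M = N" using inv[OF M(1) p] inv[OF M(2) p(1)[unfolded M(3)] p(2)] by simp
  qed
  \<comment> \<open>The inverse is taken set-theoretically; by \<open>inv\<close> its local formulas
    are the quadratic maps \<open>recovered\<close>.\<close>
  let ?f = "inv_into S plane_map"
  have fS: "?f L \<in> S" and fV: "plane_map (?f L) = L" if "L \<in> variety_of_planes_in_Y" for L
    using that inv_into_into[of L plane_map S] f_inv_into_f[of L plane_map S] by (simp_all add: im)
  have "regular_map variety_of_planes_in_Y S ?f"
  proof (rule regular_mapI[OF _ variety_of_planes_subset_proj])
    show "?f ` variety_of_planes_in_Y \<subseteq> S" using fS by blast
    fix L assume "L \<in> variety_of_planes_in_Y"
    then obtain p r k l m n s where "p \<in> L" "recovered r k l m n s p \<noteq> 0" using ex by blast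
    then show "\<exists>d F. (\<forall>j. hom_poly d (\<lambda>x. F x $ j)) \<and> (\<exists>x\<in>L. F x \<noteq> 0) \<and>
        (\<forall>L\<in>variety_of_planes_in_Y. \<forall>x\<in>L. F x \<noteq> 0 \<longrightarrow> ?f L = vec.span {F x})"
      using hom_poly_recovered inv fS fV
      by (intro exI[of _ 2] exI[of _ "recovered r k l m n s"]) auto
  qed
  moreover have "regular_map S variety_of_planes_in_Y plane_map"
  proof (rule regular_mapI[OF _ Sproj])
    show "plane_map ` S \<subseteq> variety_of_planes_in_Y" using im by simp
    fix M assume "M \<in> S"
    then obtain v h where vh: "v \<noteq> 0" "h \<noteq> 0" "M = vec.span {tensor v h}" using S by blast
    obtain i l c1 c2 c3 where q: "plane_coord i l c1 c2 c3 (tensor v h) \<noteq> 0"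
      by (rule plane_of_pluecker[OF vh(1,2)])
    \<comment> \<open>The formula chosen to be nonzero at \<open>M\<close> is correct at every point
      of \<open>S\<close> where it does not vanish.\<close>
    have "plane_map N = vec.span {plane_coord i l c1 c2 c3 z}"
      if N: "N \<in> S" and z: "z \<in> N" "plane_coord i l c1 c2 c3 z \<noteq> 0" for N z
    proof -
      obtain v h where vh: "v \<noteq> 0" "h \<noteq> 0" "N = vec.span {tensor v h}" using N S by blast
      then show ?thesis
        using exterior_plane_of_eq_span[OF vh(1,2) plane_coord_mem_span[OF vh(1,2)] z(2)] z(1) plane_map_span
        by simp
    qed
    moreover have "tensor v h \<in> M" using vh(3) by (simp add: vec.span_base)
    ultimately show "\<exists>d F. (\<forall>j. hom_poly d (\<lambda>x. F x $ j)) \<and> (\<exists>x\<in>M. F x \<noteq> 0) \<and>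
        (\<forall>L\<in>S. \<forall>x\<in>L. F x \<noteq> 0 \<longrightarrow> plane_map L = vec.span {F x})"
      using hom_poly_plane_coord q
      by (intro exI[of _ 6] exI[of _ "plane_coord i l c1 c2 c3"]) blast
  qed
  moreover have "?f (plane_map M) = M" if "M \<in> S" for M
    using inv_into_f_f[OF inj that] .
  moreover have "zariski_closed S"
    unfolding S_def W_def W_dual_def by (rule zariski_closed_segre)
  ultimately show ?thesis
    unfolding isomorphic_varieties_def S_def[symmetric]
    using zariski_closed_variety_of_planes fV by blast
qed

end
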